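(* Let $n\ge2$ and $0<\alpha<\frac12$. Suppose $f_\alpha\le0$ satisfies condition $(F)$ (with associated $S>0$ and $T$) and $$f_\alpha(x,t)\le-(t+T)^\alpha\quad\text{in }B_{\frac S2}\times[-T,0].$$ Let $u\in C^{2,1}(\mathbb R^{n+1}_-)$ be a classical solution to $u_t=\sum_{i=1}^n\arctan\lambda_i(D^2u)+f_\alpha(x,t)$ in $\mathbb R^{n+1}_-$ which is strictly convex with respect to $x$, and assume that at least one of the following holds. (a) There is $K<\infty$ with $|D^2u|\le K$ in $\mathbb R^{n+1}_-$, and at least one of the following holds for all $(x,t)\in\mathbb R^{n+1}_-$, where $\lambda_i(x,t):=\lambda_i(D^2u(x,t))$: (i) $\sum_{i=1}^n\arctan\lambda_i(x,t)\ge\frac{(n-2)\pi}2$; (ii) $\lambda_i(x,t)\ge-\epsilon(n)$ for all $1\le i\le n$; (iii) $3+\lambda_i^2(x,t)+2\lambda_i(x,t)\lambda_j(x,t)\ge0$ for all $1\le i,j\le n$. (b) $u$ is convex with respect to $x$ and, for some $R_0>0$, $\limsup_{t\to-\infty}\sup_{x\in\mathbb R^n}\frac{|u(x,t)|}{|x|^2+R_0}<\frac1{(6\sqrt n+2)^2}$. Let $A\in\mathrm{Sym}(n)$, $b\in\mathbb R^n$, $c\in\mathbb R$ and $\tau:=\sum_{i=1}^n\arctan\lambda_i(A)$ be such that $E(x,t):=u(x,t)-(\tau t+\frac12x'Ax+b\cdot x+c)$ satisfies $E=0$ in $\mathbb R^n\times(-\infty,-T]$ and, for some positive constants $C_0$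 and $\widetilde S>S$, $$|E(x,t)|\le\frac{C_0}{(t+T)^{\frac n2-2}x'(I+A^2)x}\exp\left(-\frac{x'(I+A^2)x-\widetilde S|(I+A^2)x|}{4(t+T)}\right)$$ for all sufficiently large $|x|$ and $t\in(-T,0]$. Then for any $0<\beta<1$ there exist positive constants $C$ and $\underline S>S$ such that $$|E(x,t)|\ge\frac{C}{(t+T)^{\frac n2-\alpha-2}x'(I+A^2)x}\exp\left(-\frac{x'(I+A^2)x+\underline S\,|(I+A^2)x|}{4(1-\beta)(t+T)}\right)$$ for all sufficiently large $|x|$ and all $t\in(-T,0]$.
   Context: $\mathbb R^{n+1}_-:=\mathbb R^n\times(-\infty,0]$. $\mathrm{Sym}(n)$ is the space of real symmetric $n\times n$ matrices, $x'$ is the transpose of $x$, $\lambda_i(M)$ are the eigenvalues of $M\in\mathrm{Sym}(n)$, $D^2u$ is the Hessian in $x$. $B_r\subset\mathbb R^n$ is the ball of radius $r$ centered at the origin. Condition $(F)$ for a function $f$: $f\in C^0(\mathbb R^{n+1}_-)$ and $\mathrm{supp}(f)\subset B_S\times[-T,0]$, where $T:=\sup\{-t: f(x,t)\ne0\text{ for some }x\in\mathbb R^n\}$. $\epsilon(n)>0$ is the dimensional constant (depending only on $n$) from Yuan's Bernstein theorem for the special Lagrangian equation; it is the constant in the Liouville theorem of Nguyen and Yuan that classical solutions of $v_t=\sum_i\arctan\lambda_i(D^2v)$ in $\mathbb R^{n+1}_-$ with bounded Hessian and $\lambda_i(D^2v)\ge-\epsilon(n)$ for all $i$ are of the form $\tau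 t+\frac12x'Ax+b\cdot x+c$ with $\tau=\sum_i\arctan\lambda_i(A)$. The existence of $A,b,c$ with the stated upper bound is the paper's Theorem 1.1; the statement here is the accompanying lower bound. *)

theory Defs
  imports "HOL-Analysis.Analysis" "HOL-Computational_Algebra.Polynomial" "HOL-Library.Multiset"
begin

text \<open>Functions on $\mathbf{R}^{n+1}_- = \mathbf{R}^n \times (-\infty,0]$ are total functions
  \<open>u x t\<close> with \<open>x :: real^'n\<close> and \<open>t :: real\<close>, of which only the values at \<open>t \<le> 0\<close> matter.\<close>

subsection \<open>Eigenvalues\<close>

definition charpoly :: "real^'n^'n \<Rightarrow> real poly" where
  "charpoly M = det (\<chi> i j. (if i = j then [:0, 1:] else 0) - [:M $ i $ j:])"

text \<open>The eigenvalues in increasing order, repeated according to multiplicity.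
  For symmetric \<open>M\<close> the list has length \<open>CARD('n)\<close>, so \<open>eigval M i\<close> is meaningful
  for \<open>i < CARD('n)\<close>; only symmetric matrices are used.\<close>

definition eigvals :: "real^'n^'n \<Rightarrow> real list" where
  "eigvals M = sorted_list_of_multiset (proots (charpoly M))"

definition eigval :: "real^'n^'n \<Rightarrow> nat \<Rightarrow> real" where
  "eigval M i = eigvals M ! i"

definition sum_arctan :: "real^'n^'n \<Rightarrow> real" where
  "sum_arctan M = (\<Sum>i<CARD('n). arctan (eigval M i))"

subsection \<open>Derivatives and classical solutions\<close>

definition partial :: "'n \<Rightarrow> (real^'n \<Rightarrow> real) \<Rightarrow> real^'n \<Rightarrow> real" where
  "partial i v x = deriv (\<lambda>h. v (x + h *\<^sub>R axis i 1)) 0"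

definition has_partial :: "'n \<Rightarrow> (real^'n \<Rightarrow> real) \<Rightarrow> real^'n \<Rightarrow> bool" where
  "has_partial i v x \<longleftrightarrow> (\<lambda>h. v (x + h *\<^sub>R axis i 1)) differentiable (at 0)"

definition hessian :: "(real^'n \<Rightarrow> real) \<Rightarrow> real^'n \<Rightarrow> real^'n^'n" where
  "hessian v x = (\<chi> i j. partial i (partial j v) x)"

text \<open>The Hessian in the space variable only.\<close>

definition D2 :: "(real^'n \<Rightarrow> real \<Rightarrow> real) \<Rightarrow> real^'n \<Rightarrow> real \<Rightarrow> real^'n^'n" where
  "D2 u x t = hessian (\<lambda>y. u y t) x"

text \<open>At \<open>t = 0\<close> this is the left derivative.\<close>

definition Dt :: "(real^'n \<Rightarrow> real \<Rightarrow> real) \<Rightarrow> real^'n \<Rightarrow> real \<Rightarrow> real" where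
  "Dt u x t = vector_derivative (u x) (at t within {..0})"

abbreviation continuous_lower :: "(real^'n \<Rightarrow> real \<Rightarrow> real) \<Rightarrow> bool" where
  "continuous_lower g \<equiv> continuous_on (UNIV \<times> {..0}) (\<lambda>(x, t). g x t)"

text \<open>$C^{2,1}(\mathbf{R}^{n+1}_-)$: twice in space, once in time.\<close>

definition C21 :: "(real^'n \<Rightarrow> real \<Rightarrow> real) \<Rightarrow> bool" where
  "C21 u \<longleftrightarrow>
     continuous_lower u \<and>
     (\<forall>x. \<forall>t\<le>0. u x differentiable (at t within {..0})) \<and>
     continuous_lower (Dt u) \<and>
     (\<forall>i. (\<forall>x. \<forall>t\<le>0. has_partial i (\<lambda>y. u y t) x) \<and>
          continuous_lower (\<lambda>x t. partial i (\<lambda>y. u y t) x)) \<and>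
     (\<forall>i j. (\<forall>x. \<forall>t\<le>0. has_partial i (partial j (\<lambda>y. u y t)) x) \<and>
          continuous_lower (\<lambda>x t. partial i (partial j (\<lambda>y. u y t)) x))"

definition classical_solution ::
    "(real^'n \<Rightarrow> real \<Rightarrow> real) \<Rightarrow> (real^'n \<Rightarrow> real \<Rightarrow> real) \<Rightarrow> bool" where
  "classical_solution f u \<longleftrightarrow>
     C21 u \<and> (\<forall>x. \<forall>t\<le>0. Dt u x t = sum_arctan (D2 u x t) + f x t)"

definition bounded_hessian :: "(real^'n \<Rightarrow> real \<Rightarrow> real) \<Rightarrow> bool" where
  "bounded_hessian u \<longleftrightarrow> (\<exists>K. \<forall>x. \<forall>t\<le>0. norm (D2 u x t) \<le> K)"

definition strictly_convex :: "(real^'n \<Rightarrow> real) \<Rightarrow> bool" where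
  "strictly_convex v \<longleftrightarrow>
     (\<forall>x y s. x \<noteq> y \<longrightarrow> 0 < s \<longrightarrow> s < 1 \<longrightarrow>
        v ((1 - s) *\<^sub>R x + s *\<^sub>R y) < (1 - s) * v x + s * v y)"

definition quadratic_solution ::
    "real^'n^'n \<Rightarrow> real^'n \<Rightarrow> real \<Rightarrow> real^'n \<Rightarrow> real \<Rightarrow> real" where
  "quadratic_solution A b c x t = sum_arctan A * t + 1/2 * (x \<bullet> (A *v x)) + b \<bullet> x + c"

subsection \<open>Condition (F) and the dimensional constant\<close>

text \<open>As \<open>T\<close> is a real number, the inclusion of the support already makes the set under
  \<open>Sup\<close> bounded above whenever \<open>f\<close> is not identically zero.\<close>

definition condition_F :: "(real^'n \<Rightarrow> real \<Rightarrow> real) \<Rightarrow> real \<Rightarrow> real \<Rightarrow> bool" where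
  "condition_F f S T \<longleftrightarrow>
     continuous_lower f \<and>
     T = Sup {- t | t. t \<le> 0 \<and> (\<exists>x. f x t \<noteq> 0)} \<and>
     closure {(x, t). t \<le> 0 \<and> f x t \<noteq> 0} \<subseteq> ball 0 S \<times> {- T..0}"

text \<open>$\epsilon(n)$ enters only through the Liouville theorem of Nguyen and Yuan;
  this says that \<open>\<epsilon>\<close> is a constant for which that theorem holds in dimension \<open>CARD('n)\<close>.\<close>

definition liouville_constant :: "'n::finite itself \<Rightarrow> real \<Rightarrow> bool" where
  "liouville_constant _ \<epsilon> \<longleftrightarrow>
     0 < \<epsilon> \<and>
     (\<forall>v :: real^'n \<Rightarrow> real \<Rightarrow> real.
        classical_solution (\<lambda>_ _. 0) v \<longrightarrow>
        bounded_hessian v \<longrightarrow>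
        (\<forall>x. \<forall>t\<le>0. \<forall>i<CARD('n). - \<epsilon> \<le> eigval (D2 v x t) i) \<longrightarrow>
        (\<exists>A b c. transpose A = A \<and> (\<forall>x. \<forall>t\<le>0. v x t = quadratic_solution A b c x t)))"

subsection \<open>The two alternative hypotheses on the solution\<close>

definition hypothesis_a :: "real \<Rightarrow> (real^'n \<Rightarrow> real \<Rightarrow> real) \<Rightarrow> bool" where
  "hypothesis_a \<epsilon> u \<longleftrightarrow>
     bounded_hessian u \<and>
     ((\<forall>x. \<forall>t\<le>0. (real CARD('n) - 2) * pi / 2 \<le> sum_arctan (D2 u x t)) \<or>
      (\<forall>x. \<forall>t\<le>0. \<forall>i<CARD('n). - \<epsilon> \<le> eigval (D2 u x t) i) \<or>
      (\<forall>x. \<forall>t\<le>0. \<forall>i<CARD('n). \<forall>j<CARD('n).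
         0 \<le> 3 + (eigval (D2 u x t) i)\<^sup>2 + 2 * eigval (D2 u x t) i * eigval (D2 u x t) j))"

text \<open>The supremum over \<open>x\<close> may be infinite, hence \<open>ereal\<close>.\<close>

definition hypothesis_b :: "(real^'n \<Rightarrow> real \<Rightarrow> real) \<Rightarrow> bool" where
  "hypothesis_b u \<longleftrightarrow>
     (\<forall>t\<le>0. convex_on UNIV (\<lambda>x. u x t)) \<and>
     (\<exists>R\<^sub>0>0. Limsup at_bot (\<lambda>t. SUP x. ereal (\<bar>u x t\<bar> / ((norm x)\<^sup>2 + R\<^sub>0)))
               < ereal (1 / (6 * sqrt (real CARD('n)) + 2)\<^sup>2))"

end

theory Submission
  imports Defs
begin

text \<open>Write \<open>P\<close> for the quadratic solution and \<open>v = P - u = -E\<close>. Strict convexity makes \<open>D\<^sup>2u\<close> and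
  \<open>A\<close> nonnegative, and on nonnegative matrices \<open>\<Sum> arctan \<lambda>\<^sub>i\<close> is concave with gradient
  \<open>inverse (I + A\<^sup>2)\<close> at \<open>A\<close>. Hence \<open>v\<^sub>t \<ge> tr (inverse (I + A\<^sup>2) D\<^sup>2v) - f\<close>: the error is a supersolution of a
  heat equation with constant coefficients. With
  \<open>s = t + T\<close>, the function \<open>exp (-(sqrt (x \<bullet> M x + m) + k)\<^sup>2 / (4 (1 - \<beta>) s))\<close> is a subsolution away
  from the support of the forcing once \<open>k\<close> is large; near the origin it is exponentially small in
  \<open>1 / s\<close>, hence a small multiple of it is dominated by the forcing \<open>s\<^sup>\<alpha>\<close>. The minimum principle
  puts this multiple below \<open>v\<close>, and the powers of \<open>s\<close> and \<open>x \<bullet> M x\<close> in the bound are absorbed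
  by \<open>S''\<close>.\<close>

subsection \<open>Eigenvalues of symmetric matrices\<close>

text \<open>The loss \<open>1 - \<beta>\<close> pays for replacing the heat kernel by an explicit
  subsolution. With \<open>\<theta> = 1 - \<beta>\<close>, the gradient part of the second-order
  terms of the profile is \<open>r / (\<theta> * (r + m))\<close> times its time derivative. Away
  from the origin this ratio exceeds 1 by a fixed amount, and for large \<open>k\<close> that
  surplus beats the remaining first-order term for all \<open>s \<le> T\<close>. At
  \<open>r = 0\<close> the ratio is 0, so the barrier has the wrong sign there and only the forcing
  can compensate. Three obstacles shape the rest. The domain is unbounded, so the minimum principle
  needs control at infinity; the assumed Gaussian upper bound on \<open>E\<close> supplies it. The
  constant-coefficient operator is diagonal in an eigenbasis of \<open>A\<close>, while
  \<open>C21\<close> speaks of coordinate partials only; hence the calculus of second derivatives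
  along arbitrary directions. Finally, \<open>sum_arctan\<close> is defined through roots of a
  polynomial, so concavity is reduced to the scalar arctangent by comparing two eigenbases.\<close>

lemma inner_symmetric_matrix:
  fixes A :: "real^'n^'n"
  assumes "transpose A = A"
  shows "(A *v x) \<bullet> y = x \<bullet> (A *v y)"
  by (metis assms dot_lmul_matrix transpose_matrix_vector)

section \<open>Spectral theorem for real symmetric matrices\<close>

text \<open>A maximiser \<open>x\<close> of the Rayleigh quotient on the unit sphere of
  \<open>V\<close> is an eigenvector: the first variation kills \<open>A *v x\<close> in every
  direction of \<open>V\<close> orthogonal to \<open>x\<close>, and the residual
  \<open>A *v x - \<mu> *\<^sub>R x\<close> is itself such a direction.\<close>

lemma symmetric_eigenvector_in_subspace:
  fixes A :: "real^'n^'n"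
  assumes sym: "transpose A = A" and V: "subspace V" "V \<noteq> {0}"
    and inv: "\<And>x. x \<in> V \<Longrightarrow> A *v x \<in> V"
  obtains x \<mu> where "x \<in> V" "norm x = 1" "A *v x = \<mu> *\<^sub>R x"
proof -
  let ?K = "V \<inter> sphere 0 1"
  have "compact ?K"
    using closed_subspace[OF V(1)] by (simp add: closed_Int_compact)
  moreover obtain y where y: "y \<in> V" "y \<noteq> 0"
    using V subspace_0 by blast
  have "y /\<^sub>R norm y \<in> ?K"
    using y V(1) by (auto simp: subspace_scale)
  then have "?K \<noteq> {}" by blast
  moreover have "continuous_on ?K (\<lambda>x. x \<bullet> (A *v x))"
    by (intro continuous_on_inner continuous_on_id linear_continuous_on matrix_vector_mul_bounded_linear)
  ultimately obtain x where x: "x \<in> ?K" and mx: "\<And>y. y \<in> ?K \<Longrightarrow> y \<bullet> (A *v y) \<le> x \<bullet> (A *v x)"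
    using continuous_attains_sup[of ?K "\<lambda>x. x \<bullet> (A *v x)"] by blast
  define \<mu> where "\<mu> = x \<bullet> (A *v x)"
  have xV: "x \<in> V" and nx: "norm x = 1" using x by auto
  have xx: "x \<bullet> x = 1" using nx by (simp add: dot_square_norm)
  have ray: "y \<bullet> (A *v y) \<le> \<mu> * (y \<bullet> y)" if "y \<in> V" for y
  proof (cases "y = 0")
    case False
    have "y /\<^sub>R norm y \<in> ?K"
      using that False V(1) by (auto simp: subspace_scale)
    from mx[OF this] have "(y \<bullet> (A *v y)) / (norm y)^2 \<le> \<mu>"
      by (simp add: \<mu>_def matrix_vector_mult_scaleR power2_eq_square divide_simps)
    then show ?thesis using False by (simp add: dot_square_norm divide_simps)
  qed simp
  have orth: "y \<bullet> (A *v x) = 0" if y: "y \<in> V" "x \<bullet> y = 0" for y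
  proof (rule ccontr)
    assume ne: "y \<bullet> (A *v x) \<noteq> 0"
    define p where "p = y \<bullet> (A *v x)"
    define q where "q = \<mu> * (y \<bullet> y) - y \<bullet> (A *v y)"
    have le: "2 * h * p \<le> h^2 * q" for h
    proof -
      have "x + h *\<^sub>R y \<in> V" using y xV V(1) by (simp add: subspace_add subspace_scale)
      from ray[OF this] show ?thesis
        using inner_symmetric_matrix[OF sym, of x y] y xx unfolding p_def q_def
        by (simp add: matrix_vector_right_distrib matrix_vector_mult_scaleR inner_add
            \<mu>_def[symmetric] inner_commute algebra_simps power2_eq_square)
    qed
    have "q \<ge> 0" using ray[OF y(1)] by (simp add: q_def)
    \<comment> \<open>The quadratic inequality in \<open>h\<close> is violated for small
      \<open>h\<close> of the sign of \<open>p\<close>. Dividing by \<open>q + 1\<close> covers the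
      case \<open>q = 0\<close>.\<close>
    from le[of "p / (q + 1)"] have "2 * p^2 / (q+1) \<le> p^2 * q / (q+1)^2"
      by (simp add: power2_eq_square)
    then have "2 * p^2 * (q+1) \<le> p^2 * q"
      using \<open>q \<ge> 0\<close> by (simp add: divide_simps power2_eq_square split: if_splits)
    moreover have "p^2 > 0" using ne p_def by simp
    ultimately have "2 * (q+1) \<le> q" by (simp add: mult.assoc mult.left_commute)
    with \<open>q \<ge> 0\<close> show False by simp
  qed
  define z where "z = A *v x - \<mu> *\<^sub>R x"
  have zV: "z \<in> V" unfolding z_def using inv xV V(1) by (simp add: subspace_diff subspace_scale)
  have xz: "x \<bullet> z = 0" by (simp add: z_def inner_diff_right xx \<mu>_def)
  have "z \<bullet> z = z \<bullet> (A *v x) - \<mu> * (x \<bullet> z)"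
    by (subst (2) z_def) (simp add: inner_diff_right inner_commute[of z x])
  also have "\<dots> = 0" using orth[OF zV xz] xz by simp
  finally have "A *v x = \<mu> *\<^sub>R x" by (simp add: z_def)
  with xV nx that show thesis by blast
qed

text \<open>Eigenvectors are collected one at a time: by symmetry the orthogonal complement of those
  already found is invariant under \<open>A\<close>. Indexing by the type \<open>'n\<close> lets all
  later sums run over \<open>UNIV\<close>.\<close>

lemma symmetric_orthonormal_eigenbasis:
  fixes A :: "real^'n^'n"
  assumes sym: "transpose A = A"
  obtains e :: "'n \<Rightarrow> real^'n" and l :: "'n \<Rightarrow> real"
  where "\<And>i j. e i \<bullet> e j = (if i = j then 1 else 0)" "\<And>i. A *v e i = l i *\<^sub>R e i"
proof -
  define P where "P B \<longleftrightarrow> pairwise orthogonal B \<and> (\<forall>x\<in>B. norm x = 1 \<and> (\<exists>\<mu>. A *v x = \<mu> *\<^sub>R x))"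
    for B :: "(real^'n) set"
  have "k \<le> CARD('n) \<Longrightarrow> \<exists>B. finite B \<and> card B = k \<and> P B" for k
  proof (induction k)
    case 0
    then show ?case by (intro exI[of _ "{}"]) (simp add: P_def)
  next
    case (Suc k)
    then obtain B where B: "finite B" "card B = k" "P B" by auto
    define V where "V = {x. \<forall>b\<in>B. orthogonal b x}"
    have V: "subspace V"
      unfolding V_def by (auto simp: subspace_def orthogonal_def inner_add_right)
    have "dim B < DIM(real^'n)"
      using dim_le_card[OF _ B(1), of B] B(2) Suc.prems by (auto simp: span_superset intro: le_less_trans)
    then obtain y where "y \<noteq> 0" "\<And>z. z \<in> span B \<Longrightarrow> orthogonal y z"
      using orthogonal_to_subspace_exists by blast
    then have "y \<in> V" "y \<noteq> 0"
      by (auto simp: V_def span_base orthogonal_commute[of _ y])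
    then have "V \<noteq> {0}" by blast
    moreover have "A *v x \<in> V" if "x \<in> V" for x
      unfolding V_def
    proof safe
      fix b assume b: "b \<in> B"
      then obtain \<mu> where "A *v b = \<mu> *\<^sub>R b" using B by (auto simp: P_def)
      then have "b \<bullet> (A *v x) = \<mu> * (b \<bullet> x)"
        using inner_symmetric_matrix[OF sym, of b x] by simp
      then show "orthogonal b (A *v x)"
        using that b by (simp add: V_def orthogonal_def)
    qed
    ultimately obtain x \<mu> where x: "x \<in> V" "norm x = 1" "A *v x = \<mu> *\<^sub>R x"
      using symmetric_eigenvector_in_subspace[OF sym V] by metis
    have "x \<notin> B" using x by (auto simp: V_def orthogonal_def)
    then have "card (insert x B) = Suc k" using B by simp
    moreover have "P (insert x B)"
      using B x unfolding P_def V_def by (auto simp: pairwise_insert orthogonal_commute)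
    ultimately show ?case using B(1) by blast
  qed
  then obtain B where B: "finite B" "card B = CARD('n)" "P B" by blast
  then obtain e :: "'n \<Rightarrow> real^'n" where e: "bij_betw e UNIV B"
    using finite_same_card_bij[of "UNIV :: 'n set" B] by auto
  have "e i \<bullet> e j = (if i = j then 1 else 0)" for i j
  proof -
    have "norm (e i) = 1" "i \<noteq> j \<Longrightarrow> orthogonal (e i) (e j)"
      using B(3) e unfolding P_def pairwise_def bij_betw_def inj_def by blast+
    then show ?thesis by (auto simp: orthogonal_def dot_square_norm)
  qed
  moreover have "\<forall>i. \<exists>\<mu>. A *v e i = \<mu> *\<^sub>R e i"
    using B(3) e unfolding P_def bij_betw_def by blast
  then obtain l where "\<And>i. A *v e i = l i *\<^sub>R e i" by metis
  ultimately show thesis by (rule that[of e l])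
qed

text \<open>The matrix with columns \<open>e j\<close> has its transpose as a left inverse, and for
  square matrices a left inverse is a right inverse.\<close>

lemma orthonormal_expansion:
  fixes e :: "'n \<Rightarrow> real^'n"
  assumes on: "\<And>i j. e i \<bullet> e j = (if i = j then 1 else 0)"
  shows "x = (\<Sum>k\<in>UNIV. (x \<bullet> e k) *\<^sub>R e k)"
proof -
  define Q :: "real^'n^'n" where "Q = (\<chi> i j. e j $ i)"
  have "transpose Q ** Q = mat 1"
    using on by (simp add: Q_def matrix_matrix_mult_def transpose_def mat_def vec_eq_iff inner_vec_def)
  then have "Q ** transpose Q = mat 1" using matrix_left_right_inverse by blast
  then have "x = Q *v (transpose Q *v x)"
    by (simp only: matrix_vector_mul_assoc matrix_vector_mul_lid)
  also have "\<dots> = (\<Sum>k\<in>UNIV. (x \<bullet> e k) *\<^sub>R e k)"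
    by (simp add: Q_def matrix_vector_mult_def transpose_def vec_eq_iff inner_vec_def mult.commute)
  finally show ?thesis .
qed

lemma orthonormal_parseval:
  fixes e :: "'n \<Rightarrow> real^'n"
  assumes "\<And>i j. e i \<bullet> e j = (if i = j then 1 else 0)"
  shows "x \<bullet> y = (\<Sum>k\<in>UNIV. (x \<bullet> e k) * (y \<bullet> e k))"
proof -
  have "x \<bullet> y = x \<bullet> (\<Sum>k\<in>UNIV. (y \<bullet> e k) *\<^sub>R e k)"
    using orthonormal_expansion[OF assms, of y] by simp
  then show ?thesis by (simp add: inner_sum_right mult.commute)
qed

text \<open>This bridges the definition by roots of \<open>charpoly\<close> and diagonalisation.
  Over the polynomial ring, with \<open>C\<close> embedding real matrices as constants,
  \<open>A ** Q = Q ** D\<close> becomes \<open>(X - C A) ** C Q = C Q ** (X - C D)\<close>, and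
  taking determinants gives the product of the linear factors.\<close>

lemma sum_arctan_eigenbasis:
  fixes A :: "real^'n^'n" and e :: "'n \<Rightarrow> real^'n"
  assumes on: "\<And>i j. e i \<bullet> e j = (if i = j then 1 else 0)"
    and ev: "\<And>i. A *v e i = l i *\<^sub>R e i"
  shows "sum_arctan A = (\<Sum>i\<in>UNIV. arctan (l i))"
proof -
  define C :: "real^'n^'n \<Rightarrow> real poly^'n^'n" where "C B = (\<chi> i j. [:B $ i $ j:])" for B
  define X :: "real poly^'n^'n" where "X = (\<chi> i j. if i = j then [:0, 1:] else 0)"
  define Q :: "real^'n^'n" where "Q = (\<chi> i j. e j $ i)"
  define D :: "real^'n^'n" where "D = (\<chi> i j. if i = j then l i else 0)"
  have const_sum: "[:sum g I:] = (\<Sum>i\<in>I. [:g i:])" for g :: "'n \<Rightarrow> real" and I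
  proof (induction I rule: infinite_finite_induct)
    case (insert x F)
    then show ?case by (simp flip: insert.IH)
  qed simp_all
  have Cmul: "C (B ** B') = C B ** C B'" for B B'
    by (simp add: C_def matrix_matrix_mult_def vec_eq_iff const_sum mult.commute)
  have Cone: "C (mat 1) = mat 1"
    by (simp add: C_def mat_def vec_eq_iff)
  have cp: "charpoly B = det (X - C B)" for B
    unfolding charpoly_def X_def C_def by (rule arg_cong[where f = det]) (simp add: vec_eq_iff)
  have QQ: "transpose Q ** Q = mat 1"
    using on by (simp add: Q_def matrix_matrix_mult_def transpose_def mat_def vec_eq_iff inner_vec_def)
  then have QQ': "Q ** transpose Q = mat 1" using matrix_left_right_inverse by blast
  have AQ: "A ** Q = Q ** D"
  proof -
    have "(A *v e j) $ i = l j * e j $ i" for i j using ev by simp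
    then show ?thesis
      by (simp add: Q_def D_def matrix_matrix_mult_def matrix_vector_mult_def vec_eq_iff
          if_distrib[of "\<lambda>x. _ * x"] mult.commute cong: if_cong)
  qed
  have X: "B ** X = X ** B" for B
    by (simp add: X_def matrix_matrix_mult_def vec_eq_iff if_distrib[of "\<lambda>x. _ * x"]
        if_distrib[of "\<lambda>x. x * _"] mult.commute cong: if_cong)
  have "(X - C A) ** C Q = X ** C Q - C (A ** Q)"
    unfolding Cmul
    by (simp add: matrix_matrix_mult_def vec_eq_iff left_diff_distrib sum_subtractf)
  also have "\<dots> = C Q ** (X - C D)"
    unfolding AQ Cmul X[symmetric]
    by (simp add: matrix_matrix_mult_def vec_eq_iff right_diff_distrib sum_subtractf)
  finally have "(X - C A) ** C Q = C Q ** (X - C D)" .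
  then have "det (X - C A) * det (C Q) = det (C Q) * det (X - C D)"
    by (metis det_mul)
  \<comment> \<open>So \<open>det (C Q)\<close> is a nonzero polynomial and can be
    cancelled.\<close>
  moreover have "det (C Q) * det (C (transpose Q)) = 1"
    by (metis QQ' Cmul Cone det_I det_mul)
  ultimately have "charpoly A = det (X - C D)"
    unfolding cp by (metis mult.commute mult_cancel_left mult_zero_left zero_neq_one)
  also have "\<dots> = (\<Prod>i\<in>UNIV. [:- l i, 1:])"
    by (subst det_diagonal) (simp_all add: X_def C_def D_def)
  finally have "proots (charpoly A) = (\<Sum>i\<in>UNIV. {#l i#})"
    by (simp add: proots_prod)
  then have pr: "proots (charpoly A) = image_mset l (mset_set UNIV)"
    by (simp add: sum_unfold_sum_mset)
  have ms: "mset (eigvals A) = image_mset l (mset_set UNIV)"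
    unfolding eigvals_def pr by simp
  then have len: "length (eigvals A) = CARD('n)"
    by (metis size_image_mset size_mset size_mset_set)
  have "sum_arctan A = sum_list (map arctan (eigvals A))"
    unfolding sum_arctan_def eigval_def
    by (subst sum_list_sum_nth) (simp add: len atLeast0LessThan)
  also have "\<dots> = sum_mset (image_mset arctan (mset (eigvals A)))"
    by (metis mset_map sum_mset_sum_list)
  also have "\<dots> = (\<Sum>i\<in>UNIV. arctan (l i))"
    unfolding ms by (simp add: sum_unfold_sum_mset image_mset.compositionality o_def)
  finally show ?thesis .
qed

section \<open>Concavity of the arctangent sum\<close>

text \<open>The derivative of arctan decreases on the nonnegative half-line. For very negative
  \<open>m\<close> the tangent bound can fail, which is why convexity of \<open>u\<close>
  matters.\<close>

lemma arctan_le_tangent: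
  fixes l m :: real
  assumes "0 \<le> l" "0 \<le> m"
  shows "arctan m \<le> arctan l + (m - l) / (1 + l^2)"
proof (cases m l rule: linorder_cases)
  case less
  from MVT2[OF less, of arctan "\<lambda>x. inverse (1 + x^2)"] obtain z where
    z: "m < z" "z < l" "arctan l - arctan m = (l - m) * inverse (1 + z^2)"
    using DERIV_arctan by blast
  have "inverse (1 + l^2) \<le> inverse (1 + z^2)"
    using z assms by (intro le_imp_inverse_le add_left_mono power_mono) (auto simp: add_pos_nonneg)
  then have "(l - m) * inverse (1 + l^2) \<le> arctan l - arctan m"
    unfolding z(3) using less by (intro mult_left_mono) auto
  then show ?thesis by (simp add: divide_inverse algebra_simps)
next
  case greater
  from MVT2[OF greater, of arctan "\<lambda>x. inverse (1 + x^2)"] obtain z where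
    z: "l < z" "z < m" "arctan m - arctan l = (m - l) * inverse (1 + z^2)"
    using DERIV_arctan by blast
  have "inverse (1 + z^2) \<le> inverse (1 + l^2)"
    using z assms by (intro le_imp_inverse_le add_left_mono power_mono) (auto simp: add_pos_nonneg)
  then have "arctan m - arctan l \<le> (m - l) * inverse (1 + l^2)"
    unfolding z(3) using greater by (intro mult_left_mono) auto
  then show ?thesis by (simp add: divide_inverse algebra_simps)
qed simp

text \<open>The squares \<open>p j k\<close> of the inner products of two orthonormal bases form a
  doubly stochastic matrix. Averaging the scalar tangent inequality with these weights gives the
  matrix inequality, and \<open>A\<close> and \<open>N\<close> need not commute.\<close>

lemma sum_arctan_le_linearization:
  fixes A N :: "real^'n^'n" and e :: "'n \<Rightarrow> real^'n"
  assumes on: "\<And>i j. e i \<bullet> e j = (if i = j then 1 else 0)"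
    and ev: "\<And>i. A *v e i = l i *\<^sub>R e i" and l: "\<And>i. 0 \<le> l i"
    and N: "transpose N = N" "\<And>x. 0 \<le> x \<bullet> (N *v x)"
  shows "sum_arctan N \<le> sum_arctan A + (\<Sum>j\<in>UNIV. (e j \<bullet> (N *v e j) - l j) / (1 + (l j)^2))"
proof -
  obtain g :: "'n \<Rightarrow> real^'n" and m :: "'n \<Rightarrow> real" where gon: "\<And>i j. g i \<bullet> g j = (if i = j then 1 else 0)"
    and gev: "\<And>i. N *v g i = m i *\<^sub>R g i"
    using symmetric_orthonormal_eigenbasis[OF N(1)] by metis
  have m: "0 \<le> m k" for k using N(2)[of "g k"] by (simp add: gon gev)
  define p where "p j k = (e j \<bullet> g k)^2" for j k
  have p0: "0 \<le> p j k" for j k by (simp add: p_def)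
  have pj: "(\<Sum>k\<in>UNIV. p j k) = 1" for j
    using orthonormal_parseval[OF gon, of "e j" "e j"] on[of j j] by (simp add: p_def power2_eq_square)
  have pk: "(\<Sum>j\<in>UNIV. p j k) = 1" for k
    using orthonormal_parseval[OF on, of "g k" "g k"] gon[of k k]
    by (simp add: p_def power2_eq_square inner_commute[of "g k" "e j" for j])
  have quad: "e j \<bullet> (N *v e j) = (\<Sum>k\<in>UNIV. p j k * m k)" for j
  proof -
    have "(N *v e j) \<bullet> g k = m k * (e j \<bullet> g k)" for k
      using inner_symmetric_matrix[OF N(1), of "e j" "g k"] by (simp add: gev)
    then show ?thesis
      using orthonormal_parseval[OF gon, of "e j" "N *v e j"] by (simp add: p_def power2_eq_square mult_ac)
  qed
  have "sum_arctan N = (\<Sum>k\<in>UNIV. (\<Sum>j\<in>UNIV. p j k) * arctan (m k))"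
    using sum_arctan_eigenbasis[OF gon gev] pk by simp
  also have "\<dots> = (\<Sum>j\<in>UNIV. \<Sum>k\<in>UNIV. p j k * arctan (m k))"
    by (subst sum.swap) (simp add: sum_distrib_right)
  also have "\<dots> \<le> (\<Sum>j\<in>UNIV. \<Sum>k\<in>UNIV. p j k * (arctan (l j) + (m k - l j) / (1 + (l j)^2)))"
    by (intro sum_mono mult_left_mono arctan_le_tangent l m p0)
  also have "\<dots> = (\<Sum>j\<in>UNIV. arctan (l j) + (e j \<bullet> (N *v e j) - l j) / (1 + (l j)^2))"
  proof (rule sum.cong[OF refl])
    fix j :: 'n
    have "(\<Sum>k\<in>UNIV. p j k * (arctan (l j) + (m k - l j) / (1 + (l j)^2)))
        = (\<Sum>k\<in>UNIV. p j k * (arctan (l j) - l j / (1 + (l j)^2)) + p j k * m k / (1 + (l j)^2))"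
      by (intro sum.cong refl) (simp add: algebra_simps diff_divide_distrib)
    also have "\<dots> = arctan (l j) - l j / (1 + (l j)^2) + (e j \<bullet> (N *v e j)) / (1 + (l j)^2)"
      by (simp add: sum.distrib sum_distrib_right[symmetric] pj quad sum_divide_distrib[symmetric])
    finally show "(\<Sum>k\<in>UNIV. p j k * (arctan (l j) + (m k - l j) / (1 + (l j)^2)))
        = arctan (l j) + (e j \<bullet> (N *v e j) - l j) / (1 + (l j)^2)"
      by (simp add: diff_divide_distrib)
  qed
  finally show ?thesis
    by (simp add: sum.distrib sum_arctan_eigenbasis[OF on ev])
qed

subsection \<open>Hessians of functions with continuous second partial derivatives\<close>

lemma partial_has_real_derivative:
  fixes v :: "real^'n \<Rightarrow> real"
  assumes "\<And>x. has_partial i v x"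
  shows "((\<lambda>h. v (x + h *\<^sub>R axis i 1)) has_real_derivative partial i v (x + h *\<^sub>R axis i 1)) (at h)"
proof -
  have "((\<lambda>k. v ((x + h *\<^sub>R axis i 1) + k *\<^sub>R axis i 1)) has_real_derivative
      partial i v (x + h *\<^sub>R axis i 1)) (at 0)"
    using assms[of "x + h *\<^sub>R axis i 1"] unfolding has_partial_def partial_def
    by (simp add: DERIV_deriv_iff_real_differentiable)
  then have "((\<lambda>k. v (x + (k + h) *\<^sub>R axis i 1)) has_real_derivative
      partial i v (x + h *\<^sub>R axis i 1)) (at 0)"
    by (simp add: algebra_simps)
  then show ?thesis
    using DERIV_shift[of "\<lambda>h. v (x + h *\<^sub>R axis i 1)" _ 0 h] by simp
qed

text \<open>The increment is made one coordinate at a time. The base point \<open>y\<close> varies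
  near \<open>x\<close> because each new coordinate shifts it before the induction hypothesis is
  applied.\<close>

lemma partial_increment_bound:
  fixes v :: "real^'n \<Rightarrow> real"
  assumes hp: "\<And>i x. has_partial i v x"
    and cp: "\<And>i. continuous_on UNIV (partial i v)"
    and "finite I" "0 < \<epsilon>"
  shows "\<exists>\<delta>>0. \<forall>y h. norm (y - x) < \<delta> \<longrightarrow> norm h < \<delta> \<longrightarrow>
    \<bar>v (y + (\<Sum>i\<in>I. h $ i *\<^sub>R axis i 1)) - v y - (\<Sum>i\<in>I. h $ i * partial i v x)\<bar>
      \<le> \<epsilon> * (\<Sum>i\<in>I. \<bar>h $ i\<bar>)"
  using \<open>finite I\<close>
proof (induction I)
  case empty
  then show ?case by (intro exI[of _ 1]) simp
next
  case (insert i I)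
  from insert.IH obtain \<delta>1 where \<delta>1: "\<delta>1 > 0"
    "\<And>y h. norm (y - x) < \<delta>1 \<Longrightarrow> norm h < \<delta>1 \<Longrightarrow>
      \<bar>v (y + (\<Sum>i\<in>I. h $ i *\<^sub>R axis i 1)) - v y - (\<Sum>i\<in>I. h $ i * partial i v x)\<bar>
      \<le> \<epsilon> * (\<Sum>i\<in>I. \<bar>h $ i\<bar>)" by blast
  have "isCont (partial i v) x" using cp by (simp add: continuous_on_eq_continuous_at)
  then obtain \<delta>2 where \<delta>2: "\<delta>2 > 0"
    "\<And>y. norm (y - x) < \<delta>2 \<Longrightarrow> \<bar>partial i v y - partial i v x\<bar> < \<epsilon>"
    using \<open>0 < \<epsilon>\<close> unfolding continuous_at_eps_delta dist_norm by auto
  \<comment> \<open>Halved, since moving \<open>y\<close> along one axis can double its distance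
    bound from \<open>x\<close>.\<close>
  define \<delta> where "\<delta> = min \<delta>1 \<delta>2 / 2"
  have "\<bar>v (y + (\<Sum>i\<in>insert i I. h $ i *\<^sub>R axis i 1)) - v y - (\<Sum>i\<in>insert i I. h $ i * partial i v x)\<bar>
      \<le> \<epsilon> * (\<Sum>i\<in>insert i I. \<bar>h $ i\<bar>)"
    if y: "norm (y - x) < \<delta>" and h: "norm h < \<delta>" for y h :: "real^'n"
  proof -
    have hi: "\<bar>h $ i\<bar> < \<delta>" using component_le_norm_cart[of h i] h by simp
    have near: "norm (y + k *\<^sub>R axis i 1 - x) < 2 * \<delta>" if "\<bar>k\<bar> \<le> \<bar>h $ i\<bar>" for k
    proof -
      have "norm (y + k *\<^sub>R axis i 1 - x) \<le> norm (y - x) + norm (k *\<^sub>R (axis i 1 :: real^'n))"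
        by (metis add.commute add_diff_eq norm_triangle_ineq)
      also have "norm (k *\<^sub>R (axis i 1 :: real^'n)) = \<bar>k\<bar>" by simp
      finally show ?thesis using that hi y by simp
    qed
    define y' where "y' = y + (h $ i) *\<^sub>R axis i 1"
    have 1: "\<bar>v (y' + (\<Sum>i\<in>I. h $ i *\<^sub>R axis i 1)) - v y' - (\<Sum>i\<in>I. h $ i * partial i v x)\<bar>
      \<le> \<epsilon> * (\<Sum>i\<in>I. \<bar>h $ i\<bar>)"
    proof (rule \<delta>1(2))
      show "norm (y' - x) < \<delta>1" using near[of "h $ i"] unfolding y'_def \<delta>_def by simp
      show "norm h < \<delta>1" using h \<delta>1(1) \<delta>2(1) unfolding \<delta>_def by simp
    qed
    define S where "S = {-\<bar>h $ i\<bar>..\<bar>h $ i\<bar>}"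
    define g where "g k = v (y + k *\<^sub>R axis i 1) - k * partial i v x" for k
    have "norm (g (h $ i) - g 0) \<le> \<epsilon> * norm (h $ i - 0)"
    proof (rule field_differentiable_bound[of S])
      fix k assume "k \<in> S"
      then have "norm (y + k *\<^sub>R axis i 1 - x) < 2 * \<delta>" by (intro near) (auto simp: S_def)
      then have "norm (y + k *\<^sub>R axis i 1 - x) < \<delta>2" by (simp add: \<delta>_def)
      from \<delta>2(2)[OF this] show "norm (partial i v (y + k *\<^sub>R axis i 1) - partial i v x) \<le> \<epsilon>"
        by simp
      show "(g has_field_derivative partial i v (y + k *\<^sub>R axis i 1) - partial i v x) (at k within S)"
        unfolding g_def
        by (rule has_field_derivative_at_within)
          (auto intro!: derivative_eq_intros partial_has_real_derivative hp)
    qed (auto simp: S_def)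
    then have 2: "\<bar>v y' - v y - h $ i * partial i v x\<bar> \<le> \<epsilon> * \<bar>h $ i\<bar>"
      by (simp add: g_def y'_def)
    have "y + (\<Sum>i\<in>insert i I. h $ i *\<^sub>R axis i 1) = y' + (\<Sum>i\<in>I. h $ i *\<^sub>R axis i 1)"
      using insert.hyps by (simp add: y'_def)
    note eqs = this
    have "(\<Sum>i\<in>insert i I. h $ i * partial i v x) = h $ i * partial i v x + (\<Sum>i\<in>I. h $ i * partial i v x)"
      "\<epsilon> * (\<Sum>i\<in>insert i I. \<bar>h $ i\<bar>) = \<epsilon> * \<bar>h $ i\<bar> + \<epsilon> * (\<Sum>i\<in>I. \<bar>h $ i\<bar>)"
      using insert.hyps by (simp_all add: distrib_left)
    note eqs = eqs this
    show ?thesis using 1 2 unfolding eqs by linarith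
  qed
  moreover have "\<delta> > 0" using \<delta>1 \<delta>2 by (simp add: \<delta>_def)
  ultimately show ?case by blast
qed

lemma continuous_partials_imp_has_derivative:
  fixes v :: "real^'n \<Rightarrow> real"
  assumes hp: "\<And>i x. has_partial i v x"
    and cp: "\<And>i. continuous_on UNIV (partial i v)"
  shows "(v has_derivative (\<lambda>h. \<Sum>i\<in>UNIV. h $ i * partial i v x)) (at x)"
  unfolding has_derivative_at_alt
proof (intro conjI allI impI)
  show "bounded_linear (\<lambda>h::real^'n. \<Sum>i\<in>UNIV. h $ i * partial i v x)"
    by (intro bounded_linear_sum bounded_linear_mult_const bounded_linear_vec_nth)
  fix e :: real assume "0 < e"
  then have "0 < e / CARD('n)" by simp
  from partial_increment_bound[where I = UNIV and x = x, OF hp cp finite this] obtain \<delta> where \<delta>: "\<delta> > 0"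
    "\<And>y h. norm (y - x) < \<delta> \<Longrightarrow> norm h < \<delta> \<Longrightarrow>
      \<bar>v (y + (\<Sum>i\<in>UNIV. h $ i *\<^sub>R axis i 1)) - v y - (\<Sum>i\<in>UNIV. h $ i * partial i v x)\<bar>
      \<le> e / CARD('n) * (\<Sum>i\<in>UNIV. \<bar>h $ i\<bar>)" by blast
  have "norm (v y - v x - (\<Sum>i\<in>UNIV. (y - x) $ i * partial i v x)) \<le> e * norm (y - x)"
    if "norm (y - x) < \<delta>" for y
  proof -
    have "(\<Sum>i\<in>UNIV. (y - x) $ i *\<^sub>R axis i 1) = y - x"
      using basis_expansion[of "y - x"] by (simp add: scalar_mult_eq_scaleR)
    with \<delta>(2)[of x, OF _ that] \<delta>(1)
    have "norm (v y - v x - (\<Sum>i\<in>UNIV. (y - x) $ i * partial i v x))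
        \<le> e / CARD('n) * (\<Sum>i\<in>UNIV. \<bar>(y - x) $ i\<bar>)" by simp
    also have "\<dots> \<le> e / CARD('n) * (\<Sum>i\<in>(UNIV::'n set). norm (y - x))"
      using \<open>0 < e\<close> by (intro mult_left_mono sum_mono component_le_norm_cart) simp
    finally show ?thesis by simp
  qed
  with \<delta>(1) show "\<exists>d>0. \<forall>y. norm (y - x) < d \<longrightarrow>
      norm (v y - v x - (\<Sum>i\<in>UNIV. (y - x) $ i * partial i v x)) \<le> e * norm (y - x)" by blast
qed

section \<open>Second derivatives along lines\<close>

text \<open>A relation rather than an iterated \<open>deriv\<close>: it carries the existence of the
  derivatives along with the value. The first derivative is required everywhere, for the mean value
  theorem; the second only at 0, the point under study.\<close>

definition has_second_deriv :: "(real \<Rightarrow> real) \<Rightarrow> real \<Rightarrow> bool" where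
  "has_second_deriv g d \<longleftrightarrow>
     (\<exists>g'. (\<forall>h. (g has_real_derivative g' h) (at h)) \<and> (g' has_real_derivative d) (at 0))"

lemma has_second_derivI:
  assumes "\<And>h. (g has_real_derivative g' h) (at h)" "(g' has_real_derivative d) (at 0)"
  shows "has_second_deriv g d"
  using assms unfolding has_second_deriv_def by blast

lemma has_second_deriv_add:
  assumes "has_second_deriv g c" "has_second_deriv h d"
  shows "has_second_deriv (\<lambda>x. g x + h x) (c + d)"
proof -
  obtain g' h' where "\<And>x. (g has_real_derivative g' x) (at x)" "(g' has_real_derivative c) (at 0)"
    "\<And>x. (h has_real_derivative h' x) (at x)" "(h' has_real_derivative d) (at 0)"
    using assms unfolding has_second_deriv_def by blast
  then show ?thesis
    by (intro has_second_derivI[of _ "\<lambda>x. g' x + h' x"] DERIV_add)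
qed

lemma has_second_deriv_cmult:
  assumes "has_second_deriv g d"
  shows "has_second_deriv (\<lambda>x. c * g x) (c * d)"
proof -
  obtain g' where "\<And>x. (g has_real_derivative g' x) (at x)" "(g' has_real_derivative d) (at 0)"
    using assms unfolding has_second_deriv_def by blast
  then show ?thesis
    by (intro has_second_derivI[of _ "\<lambda>x. c * g' x"] DERIV_cmult)
qed

lemma has_second_deriv_affine: "has_second_deriv (\<lambda>h. a * h + b) 0"
  by (rule has_second_derivI[of _ "\<lambda>_. a"]) (auto intro!: derivative_eq_intros)

lemma has_second_deriv_quadratic: "has_second_deriv (\<lambda>h. c + a * h + b * h^2) (2 * b)"
  by (rule has_second_derivI[of _ "\<lambda>h. a + 2 * b * h"])
    (auto intro!: derivative_eq_intros simp: power2_eq_square)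

lemma has_second_deriv_diff:
  assumes "has_second_deriv g c" "has_second_deriv h d"
  shows "has_second_deriv (\<lambda>x. g x - h x) (c - d)"
  using has_second_deriv_add[OF assms(1) has_second_deriv_cmult[OF assms(2), of "-1"]] by simp

lemma second_deriv_nonneg_at_min:
  assumes "has_second_deriv g d" and mn: "\<And>h. g 0 \<le> g h"
  shows "0 \<le> d"
proof (rule ccontr)
  assume "\<not> 0 \<le> d"
  obtain g' where g': "\<And>h. (g has_real_derivative g' h) (at h)" and d: "(g' has_real_derivative d) (at 0)"
    using assms(1) unfolding has_second_deriv_def by blast
  have g'0: "g' 0 = 0"
    using DERIV_local_min[OF g'[of 0], of 1] mn by simp
  obtain \<delta> where \<delta>: "\<delta> > 0" "\<And>h. 0 < h \<Longrightarrow> h < \<delta> \<Longrightarrow> g' (0 + h) < g' 0"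
    using DERIV_neg_dec_right[OF d] \<open>\<not> 0 \<le> d\<close> by auto
  obtain z where z: "0 < z" "z < \<delta>/2" "g (\<delta>/2) - g 0 = (\<delta>/2 - 0) * g' z"
    using MVT2[of 0 "\<delta>/2" g g'] g' \<delta>(1) by auto
  have "g' z < 0" using \<delta>(2)[of z] z \<delta>(1) g'0 by simp
  then have "(\<delta>/2 - 0) * g' z < 0" using \<delta>(1) by (simp add: mult_pos_neg)
  with z(3) mn[of "\<delta>/2"] show False by simp
qed

text \<open>Subtracting the tangent at 0 turns convexity into a global minimum at 0 without changing
  the second derivative.\<close>

lemma second_deriv_nonneg_of_convex:
  assumes "has_second_deriv g d" "convex_on UNIV g"
  shows "0 \<le> d"
proof -
  obtain g' where g': "\<And>h. (g has_real_derivative g' h) (at h)" and d: "(g' has_real_derivative d) (at 0)"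
    using assms(1) unfolding has_second_deriv_def by blast
  have tan: "g h - g 0 \<ge> g' 0 * (h - 0)" for h
    using convex_on_imp_above_tangent[OF assms(2), of 0 h "g' 0"] g'[of 0] by simp
  have "has_second_deriv (\<lambda>h. g h - (g' 0 * h + 0)) (d - 0)"
    by (intro has_second_deriv_diff assms has_second_deriv_affine)
  then show ?thesis
    using second_deriv_nonneg_at_min[of "\<lambda>h. g h - (g' 0 * h + 0)" d] tan by (simp add: algebra_simps)
qed

lemma hessian_has_second_deriv:
  fixes v :: "real^'n \<Rightarrow> real"
  assumes hp: "\<And>i x. has_partial i v x"
    and cp: "\<And>i. continuous_on UNIV (partial i v)"
    and hp2: "\<And>i j x. has_partial i (partial j v) x"
    and cp2: "\<And>i j. continuous_on UNIV (partial i (partial j v))"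
  shows "has_second_deriv (\<lambda>h. v (x + h *\<^sub>R \<xi>)) (\<xi> \<bullet> (hessian v x *v \<xi>))"
proof -
  have chain: "((\<lambda>h. w (x + h *\<^sub>R \<xi>)) has_real_derivative (\<Sum>i\<in>UNIV. \<xi> $ i * partial i w (x + h *\<^sub>R \<xi>))) (at h)"
    if w: "\<And>i x. has_partial i w x" "\<And>i. continuous_on UNIV (partial i w)" for w h
  proof -
    have "((\<lambda>h. x + h *\<^sub>R \<xi>) has_derivative (\<lambda>k. k *\<^sub>R \<xi>)) (at h)"
      by (auto intro!: derivative_eq_intros)
    from has_derivative_compose[OF this continuous_partials_imp_has_derivative[OF w]]
    show ?thesis
      unfolding has_field_derivative_def
      by (rule has_derivative_eq_rhs) (simp add: fun_eq_iff sum_distrib_left mult_ac)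
  qed
  have eq: "\<xi> \<bullet> (hessian v x *v \<xi>)
      = (\<Sum>j\<in>UNIV. \<xi> $ j * (\<Sum>i\<in>UNIV. \<xi> $ i * partial i (partial j v) (x + 0 *\<^sub>R \<xi>)))"
  proof -
    have "\<xi> \<bullet> (hessian v x *v \<xi>) = (\<Sum>i\<in>UNIV. \<Sum>j\<in>UNIV. \<xi> $ i * (partial i (partial j v) x * \<xi> $ j))"
      by (simp add: inner_vec_def matrix_vector_mult_def hessian_def sum_distrib_left)
    also have "\<dots> = (\<Sum>j\<in>UNIV. \<Sum>i\<in>UNIV. \<xi> $ i * (partial i (partial j v) x * \<xi> $ j))"
      by (rule sum.swap)
    finally show ?thesis by (simp add: sum_distrib_left mult_ac)
  qed
  show ?thesis
  proof (rule has_second_derivI[of _ "\<lambda>h. \<Sum>j\<in>UNIV. \<xi> $ j * partial j v (x + h *\<^sub>R \<xi>)"])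
    show "((\<lambda>h. v (x + h *\<^sub>R \<xi>)) has_real_derivative (\<Sum>j\<in>UNIV. \<xi> $ j * partial j v (x + h *\<^sub>R \<xi>))) (at h)" for h
      by (rule chain[OF hp cp])
    show "((\<lambda>h. \<Sum>j\<in>UNIV. \<xi> $ j * partial j v (x + h *\<^sub>R \<xi>)) has_real_derivative
      \<xi> \<bullet> (hessian v x *v \<xi>)) (at 0)"
      unfolding eq by (intro DERIV_sum DERIV_cmult chain hp2 cp2)
  qed
qed

section \<open>Symmetry and sign of the Hessian\<close>

lemma second_difference_mean_value:
  fixes v :: "real^'n \<Rightarrow> real"
  assumes hp: "\<And>i x. has_partial i v x"
    and hp2: "\<And>i j x. has_partial i (partial j v) x" and "0 < h"
  shows "\<exists>s t. 0 < s \<and> s < h \<and> 0 < t \<and> t < h \<and>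
    v (x + h *\<^sub>R axis i 1 + h *\<^sub>R axis j 1) - v (x + h *\<^sub>R axis i 1) - v (x + h *\<^sub>R axis j 1) + v x
      = h^2 * partial i (partial j v) (x + s *\<^sub>R axis i 1 + t *\<^sub>R axis j 1)"
proof -
  define a b :: "real^'n" where "a = axis i 1" and "b = axis j 1"
  define G where "G k = v (x + h *\<^sub>R a + k *\<^sub>R b) - v (x + k *\<^sub>R b)" for k
  define G' where "G' k = partial j v (x + h *\<^sub>R a + k *\<^sub>R b) - partial j v (x + k *\<^sub>R b)" for k
  have "(G has_real_derivative G' k) (at k)" for k
    unfolding G_def G'_def b_def
    by (intro DERIV_diff partial_has_real_derivative hp)
  then obtain t where t: "0 < t" "t < h" "G h - G 0 = (h - 0) * G' t"
    using MVT2[of 0 h G G'] \<open>0 < h\<close> by blast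
  have "((\<lambda>k. partial j v (x + t *\<^sub>R b + k *\<^sub>R a)) has_real_derivative
      partial i (partial j v) (x + t *\<^sub>R b + k *\<^sub>R a)) (at k)" for k
    unfolding a_def by (intro partial_has_real_derivative hp2)
  then obtain s where s: "0 < s" "s < h"
    "partial j v (x + t *\<^sub>R b + h *\<^sub>R a) - partial j v (x + t *\<^sub>R b + 0 *\<^sub>R a)
      = (h - 0) * partial i (partial j v) (x + t *\<^sub>R b + s *\<^sub>R a)"
    using MVT2[of 0 h "\<lambda>k. partial j v (x + t *\<^sub>R b + k *\<^sub>R a)"
        "\<lambda>k. partial i (partial j v) (x + t *\<^sub>R b + k *\<^sub>R a)"] \<open>0 < h\<close> by blast
  have "G' t = h * partial i (partial j v) (x + s *\<^sub>R a + t *\<^sub>R b)"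
    using s(3) by (simp add: G'_def add_ac)
  with t(3) have "G h - G 0 = h^2 * partial i (partial j v) (x + s *\<^sub>R a + t *\<^sub>R b)"
    by (simp add: power2_eq_square)
  with s t show ?thesis unfolding G_def a_def b_def
    by (intro exI[of _ s] exI[of _ t]) (simp add: algebra_simps)
qed

text \<open>The mixed second difference over a small square does not depend on the order of the two
  axes. Applying the mean value theorem in both orders equates the two mixed partials at nearby
  points, and continuity carries this to \<open>x\<close>. Symmetry is what admits the Hessian to
  the spectral theorem.\<close>

lemma hessian_symmetric:
  fixes v :: "real^'n \<Rightarrow> real"
  assumes hp: "\<And>i x. has_partial i v x"
    and hp2: "\<And>i j x. has_partial i (partial j v) x"
    and cp2: "\<And>i j. continuous_on UNIV (partial i (partial j v))"
  shows "transpose (hessian v x) = hessian v x"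
proof -
  have "partial i (partial j v) x = partial j (partial i v) x" for i j
  proof (rule ccontr)
    assume ne: "partial i (partial j v) x \<noteq> partial j (partial i v) x"
    define \<epsilon> where "\<epsilon> = \<bar>partial i (partial j v) x - partial j (partial i v) x\<bar> / 2"
    have "\<epsilon> > 0" using ne by (simp add: \<epsilon>_def)
    have "\<exists>\<delta>>0. \<forall>y. norm (y - x) < \<delta> \<longrightarrow> \<bar>partial i (partial j v) y - partial i (partial j v) x\<bar> < \<epsilon>" for i j
      using cp2[of i j] \<open>\<epsilon> > 0\<close>
      unfolding continuous_on_eq_continuous_at[OF open_UNIV] continuous_at_eps_delta dist_norm by auto
    then obtain \<delta> where \<delta>: "\<And>i j. \<delta> i j > 0"
      "\<And>i j y. norm (y - x) < \<delta> i j \<Longrightarrow> \<bar>partial i (partial j v) y - partial i (partial j v) x\<bar> < \<epsilon>"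
      by metis
    define h where "h = min (\<delta> i j) (\<delta> j i) / 2"
    have h: "h > 0" using \<delta>(1) by (simp add: h_def)
    have near: "norm (x + s *\<^sub>R axis i' 1 + t *\<^sub>R axis j' 1 - x) < 2 * h"
      if "0 < s" "s < h" "0 < t" "t < h" for s t i' j'
    proof -
      have "norm (s *\<^sub>R (axis i' 1::real^'n) + t *\<^sub>R axis j' 1) \<le> norm (s *\<^sub>R (axis i' 1::real^'n)) + norm (t *\<^sub>R (axis j' 1::real^'n))"
        by (rule norm_triangle_ineq)
      then show ?thesis using that by (simp add: add.assoc)
    qed
    obtain s t where st: "0 < s" "s < h" "0 < t" "t < h" and
      1: "v (x + h *\<^sub>R axis i 1 + h *\<^sub>R axis j 1) - v (x + h *\<^sub>R axis i 1) - v (x + h *\<^sub>R axis j 1) + v x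
      = h^2 * partial i (partial j v) (x + s *\<^sub>R axis i 1 + t *\<^sub>R axis j 1)"
      using second_difference_mean_value[OF hp hp2 h] by blast
    obtain s' t' where st': "0 < s'" "s' < h" "0 < t'" "t' < h" and
      2: "v (x + h *\<^sub>R axis j 1 + h *\<^sub>R axis i 1) - v (x + h *\<^sub>R axis j 1) - v (x + h *\<^sub>R axis i 1) + v x
      = h^2 * partial j (partial i v) (x + s' *\<^sub>R axis j 1 + t' *\<^sub>R axis i 1)"
      using second_difference_mean_value[OF hp hp2 h] by blast
    have "h^2 * partial i (partial j v) (x + s *\<^sub>R axis i 1 + t *\<^sub>R axis j 1)
        = h^2 * partial j (partial i v) (x + s' *\<^sub>R axis j 1 + t' *\<^sub>R axis i 1)"
      unfolding 1[symmetric] 2[symmetric] by (simp add: add_ac)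
    then have eq: "partial i (partial j v) (x + s *\<^sub>R axis i 1 + t *\<^sub>R axis j 1)
        = partial j (partial i v) (x + s' *\<^sub>R axis j 1 + t' *\<^sub>R axis i 1)"
      using h by simp
    have "2 * h \<le> \<delta> i j" "2 * h \<le> \<delta> j i" by (auto simp: h_def)
    then have "\<bar>partial i (partial j v) (x + s *\<^sub>R axis i 1 + t *\<^sub>R axis j 1) - partial i (partial j v) x\<bar> < \<epsilon>"
      "\<bar>partial j (partial i v) (x + s' *\<^sub>R axis j 1 + t' *\<^sub>R axis i 1) - partial j (partial i v) x\<bar> < \<epsilon>"
      using near[OF st, of i j] near[OF st', of j i] by (auto intro!: \<delta>(2))
    then have "\<bar>partial i (partial j v) x - partial j (partial i v) x\<bar> < \<epsilon> + \<epsilon>"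
      unfolding eq by linarith
    then show False by (simp add: \<epsilon>_def)
  qed
  then show ?thesis by (simp add: transpose_def hessian_def vec_eq_iff)
qed

lemma convex_on_line:
  fixes v :: "'a::real_vector \<Rightarrow> real"
  assumes cv: "convex_on UNIV v"
  shows "convex_on UNIV (\<lambda>h. v (x + h *\<^sub>R \<xi>))"
proof (rule convex_onI)
  fix t a b :: real assume t: "0 < t" "t < 1"
  have "x + ((1 - t) *\<^sub>R a + t *\<^sub>R b) *\<^sub>R \<xi> = (1 - t) *\<^sub>R (x + a *\<^sub>R \<xi>) + t *\<^sub>R (x + b *\<^sub>R \<xi>)"
    by (simp add: algebra_simps)
  then show "v (x + ((1 - t) *\<^sub>R a + t *\<^sub>R b) *\<^sub>R \<xi>) \<le> (1 - t) * v (x + a *\<^sub>R \<xi>) + t * v (x + b *\<^sub>R \<xi>)"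
    using convex_onD[OF cv, of t "x + a *\<^sub>R \<xi>" "x + b *\<^sub>R \<xi>"] t by simp
qed simp

lemma hessian_nonneg_of_convex:
  fixes v :: "real^'n \<Rightarrow> real"
  assumes "\<And>i x. has_partial i v x" "\<And>i. continuous_on UNIV (partial i v)"
    "\<And>i j x. has_partial i (partial j v) x" "\<And>i j. continuous_on UNIV (partial i (partial j v))"
    and cv: "convex_on UNIV v"
  shows "0 \<le> \<xi> \<bullet> (hessian v x *v \<xi>)"
proof (rule second_deriv_nonneg_of_convex)
  show "has_second_deriv (\<lambda>h. v (x + h *\<^sub>R \<xi>)) (\<xi> \<bullet> (hessian v x *v \<xi>))"
    by (rule hessian_has_second_deriv) fact+
  show "convex_on UNIV (\<lambda>h. v (x + h *\<^sub>R \<xi>))"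
    by (rule convex_on_line[OF cv])
qed

subsection \<open>Minimum principle and Gaussian barriers\<close>

lemma parabolic_minimum_principle:
  fixes z :: "real^'n \<Rightarrow> real \<Rightarrow> real" and e :: "'i \<Rightarrow> real^'n"
  assumes cont: "continuous_on (UNIV \<times> {t0..t1}) (\<lambda>(x, t). z x t)"
    and init: "\<And>x. 0 \<le> z x t0"
    and decay: "\<And>\<mu>. 0 < \<mu> \<Longrightarrow> \<forall>\<^sub>F x in at_infinity. \<forall>t\<in>{t0..t1}. - \<mu> \<le> z x t"
    and kappa: "\<And>j. j \<in> I \<Longrightarrow> 0 \<le> \<kappa> j"
    and super: "\<And>x t. t0 < t \<Longrightarrow> t \<le> t1 \<Longrightarrow> \<exists>D d.
        (z x has_real_derivative D) (at t within {..t}) \<and>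
        (\<forall>j\<in>I. has_second_deriv (\<lambda>h. z (x + h *\<^sub>R e j) t) (d j)) \<and>
        (\<Sum>j\<in>I. \<kappa> j * d j) \<le> D"
    and t: "t \<in> {t0..t1}"
  shows "0 \<le> z x t"
proof (rule ccontr)
  assume "\<not> 0 \<le> z x t"
  \<comment> \<open>Half the depth of the negative value: adding a time drift of at most
    \<open>\<mu>\<close> still leaves \<open>- \<mu>\<close> or less at this point, whereas outside
    a large ball the function stays above \<open>- \<mu> / 2\<close>.\<close>
  define \<mu> where "\<mu> = - z x t / 2"
  have mu: "\<mu> > 0" using \<open>\<not> 0 \<le> z x t\<close> by (simp add: \<mu>_def)
  define \<delta> where "\<delta> = \<mu> / (t1 - t0 + 1)"
  have dpos: "\<delta> > 0" using mu t by (simp add: \<delta>_def)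
  have dle: "\<delta> * (s - t0) \<le> \<mu>" if "s \<in> {t0..t1}" for s
  proof -
    have "\<delta> * (s - t0) \<le> \<delta> * (t1 - t0 + 1)" using dpos that by (intro mult_left_mono) auto
    also have "\<dots> = \<mu>" using t by (simp add: \<delta>_def)
    finally show ?thesis .
  qed
  \<comment> \<open>The term \<open>\<delta> * (t - t0)\<close> makes the supersolution inequality strict.\<close>
  define y where "y p = z (fst p) (snd p) + \<delta> * (snd p - t0)" for p
  have "\<forall>\<^sub>F x in at_infinity. \<forall>t\<in>{t0..t1}. - (\<mu> / 2) \<le> z x t"
    using decay[of "\<mu> / 2"] mu by simp
  then obtain R0 where R0: "\<And>x s. R0 \<le> norm x \<Longrightarrow> s \<in> {t0..t1} \<Longrightarrow> - (\<mu> / 2) \<le> z x s"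
    unfolding eventually_at_infinity by blast
  define R where "R = max R0 (norm x)"
  let ?K = "cball (0 :: real^'n) R \<times> {t0..t1}"
  have "compact ?K" by (intro compact_Times) auto
  moreover have xt: "(x, t) \<in> ?K" using t by (simp add: R_def)
  moreover have "continuous_on ?K y"
    unfolding y_def
    by (intro continuous_intros continuous_on_subset[OF cont[unfolded case_prod_beta]]) auto
  ultimately obtain p where p: "p \<in> ?K" "\<And>q. q \<in> ?K \<Longrightarrow> y p \<le> y q"
    using continuous_attains_inf[of ?K y] by blast
  obtain x1 s where ps: "p = (x1, s)" by (cases p)
  have s: "s \<in> {t0..t1}" using p ps by auto
  have "y (x, t) \<le> - \<mu>" using dle[OF t] by (simp add: y_def \<mu>_def)
  then have ymin: "y p \<le> - \<mu>" using p(2)[OF xt] by simp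
  have glob: "y p \<le> y (x', s')" if s': "s' \<in> {t0..t1}" for x' s'
  proof (cases "norm x' \<le> R")
    case True
    then show ?thesis using p(2) s' by simp
  next
    case False
    then have "- (\<mu> / 2) \<le> z x' s'" using R0[of x' s'] s' by (simp add: R_def)
    moreover have "0 \<le> \<delta> * (s' - t0)" using dpos s' by simp
    ultimately show ?thesis using ymin mu unfolding y_def by simp
  qed
  have "s \<noteq> t0"
  proof
    assume "s = t0"
    then have "0 \<le> y p" using init by (simp add: y_def ps)
    then show False using ymin mu by simp
  qed
  then have s0: "t0 < s" "s \<le> t1" using s by auto
  then obtain D d where D: "(z x1 has_real_derivative D) (at s within {..s})"
    and dd: "\<And>j. j \<in> I \<Longrightarrow> has_second_deriv (\<lambda>h. z (x1 + h *\<^sub>R e j) s) (d j)"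
    and le: "(\<Sum>j\<in>I. \<kappa> j * d j) \<le> D"
    using super[OF s0, of x1] by blast
  have "0 \<le> d j" if "j \<in> I" for j
  proof (rule second_deriv_nonneg_at_min[OF dd[OF that]])
    fix h show "z (x1 + 0 *\<^sub>R e j) s \<le> z (x1 + h *\<^sub>R e j) s"
      using glob[OF s, of "x1 + h *\<^sub>R e j"] by (simp add: y_def ps)
  qed
  then have "0 \<le> (\<Sum>j\<in>I. \<kappa> j * d j)"
    by (intro sum_nonneg mult_nonneg_nonneg kappa)
  then have pos: "D + \<delta> > 0" using le dpos by linarith
  \<comment> \<open>A positive left derivative at the minimum would give a smaller value at a
    slightly earlier time.\<close>
  have "((\<lambda>r. y (x1, r)) has_real_derivative D + \<delta>) (at s within {..s})"
    unfolding y_def using D by (auto intro!: derivative_eq_intros)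
  from has_real_derivative_pos_inc_left[OF this pos] obtain \<eta> where \<eta>: "\<eta> > 0"
    "\<And>h. h > 0 \<Longrightarrow> s - h \<in> {..s} \<Longrightarrow> h < \<eta> \<Longrightarrow> y (x1, s - h) < y (x1, s)"
    by blast
  define h where "h = min (\<eta> / 2) (s - t0)"
  have "h > 0" "h < \<eta>" "s - h \<in> {t0..t1}" using \<eta>(1) s0 by (auto simp: h_def)
  then show False using \<eta>(2)[of h] glob[of "s - h" x1] by (simp add: ps)
qed

section \<open>Gaussian barriers and their defect\<close>

text \<open>From \<open>(1 + y / N) ^ N \<le> exp y\<close> with \<open>y = a / s\<close>, the
  exponential contributes \<open>s ^ N\<close>; \<open>N\<close> is chosen so that
  \<open>p + N\<close> is nonnegative, which makes the remaining power monotone in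
  \<open>s\<close>.\<close>

lemma powr_mult_exp_inverse_bounded:
  fixes a T p :: real
  assumes "0 < a" "0 < T"
  shows "\<exists>K>0. \<forall>s\<in>{0<..T}. s powr p * exp (- (a / s)) \<le> K"
proof -
  define N where "N = Suc (nat \<lceil>- p\<rceil>)"
  have N: "0 \<le> p + N" "N > 0" unfolding N_def by linarith+
  have "s powr p * exp (- (a / s)) \<le> (N / a) ^ N * T powr (p + N)" if s: "s \<in> {0<..T}" for s
  proof -
    have "(a / s / N) ^ N \<le> (1 + (a / s) / N) ^ N"
      using assms s by (intro power_mono) auto
    also have "\<dots> \<le> exp (a / s)"
      using assms s N by (intro exp_ge_one_plus_x_over_n_power_n) (auto intro: order_trans[of _ 0])
    finally have "exp (- (a / s)) \<le> inverse ((a / s / N) ^ N)"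
      using assms s N by (simp add: exp_minus)
    also have "\<dots> = (N / a) ^ N * s powr N"
      using s assms N by (simp add: powr_realpow power_divide field_simps)
    finally have "s powr p * exp (- (a / s)) \<le> s powr p * ((N / a) ^ N * s powr N)"
      by (intro mult_left_mono) auto
    also have "\<dots> = (N / a) ^ N * s powr (p + N)" by (simp add: powr_add)
    also have "\<dots> \<le> (N / a) ^ N * T powr (p + N)"
      using s N assms by (intro mult_left_mono powr_mono2) auto
    finally show ?thesis .
  qed
  moreover have "0 < (N / a) ^ N * T powr (p + N)" using assms N by simp
  ultimately show ?thesis by blast
qed

text \<open>The barrier is a multiple of this profile with \<open>r = x \<bullet> M x\<close>, \<open>p = 1 / (4 \<theta> s)\<close> and
  \<open>\<theta> = 1 - \<beta>\<close>. For large \<open>k\<close> the profile is a subsolution up to the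
  ball where the forcing acts, and \<open>m > 0\<close> removes the kink of \<open>sqrt r\<close> at the origin.\<close>

definition gauss_profile :: "real \<Rightarrow> real \<Rightarrow> real \<Rightarrow> real \<Rightarrow> real" where
  "gauss_profile m k p r = exp (- p * (sqrt (r + m) + k)^2)"

definition gauss_profile' :: "real \<Rightarrow> real \<Rightarrow> real \<Rightarrow> real \<Rightarrow> real" where
  "gauss_profile' m k p r = - p * (1 + k / sqrt (r + m)) * gauss_profile m k p r"

definition gauss_profile'' :: "real \<Rightarrow> real \<Rightarrow> real \<Rightarrow> real \<Rightarrow> real" where
  "gauss_profile'' m k p r =
     (p^2 * (1 + k / sqrt (r + m))^2 + p * k / (2 * sqrt (r + m) ^ 3)) * gauss_profile m k p r"

lemma gauss_profile_deriv:
  assumes "0 < r + m"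
  shows "(gauss_profile m k p has_real_derivative gauss_profile' m k p r) (at r)"
proof -
  have sq: "sqrt (r + m) > 0" using assms by simp
  have eq: "- p * (2 * (y + k)) * (1 / (2 * y)) = - p * (1 + k / y)" if "y > 0" for y
    using that by (simp add: field_simps)
  have "((\<lambda>r. sqrt (r + m)) has_real_derivative 1 / (2 * sqrt (r + m))) (at r)"
    using assms by (auto intro!: derivative_eq_intros simp: inverse_eq_divide)
  moreover have "((\<lambda>y. - p * (y + k)^2) has_real_derivative - p * (2 * (y + k))) (at y)" for y
    by (auto intro!: derivative_eq_intros)
  ultimately have "((\<lambda>r. - p * (sqrt (r + m) + k)^2) has_real_derivative
      - p * (2 * (sqrt (r + m) + k)) * (1 / (2 * sqrt (r + m)))) (at r)"
    using DERIV_chain2 by blast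
  also have "- p * (2 * (sqrt (r + m) + k)) * (1 / (2 * sqrt (r + m))) = - p * (1 + k / sqrt (r + m))"
    using eq[OF sq] .
  finally have "((\<lambda>r. - p * (sqrt (r + m) + k)^2) has_real_derivative - p * (1 + k / sqrt (r + m))) (at r)" .
  from DERIV_fun_exp[OF this] show ?thesis
    unfolding gauss_profile_def[abs_def] gauss_profile'_def
    by (rule DERIV_cong) (rule mult.commute)
qed

lemma gauss_profile'_deriv:
  assumes "0 < r + m"
  shows "(gauss_profile' m k p has_real_derivative gauss_profile'' m k p r) (at r)"
proof -
  have sq: "sqrt (r + m) > 0" using assms by simp
  have eq: "c * W + (- p * u * W) * (- p * u) = (p^2 * u^2 + c) * W" for c W u :: real
    by (simp add: algebra_simps power2_eq_square)
  have "((\<lambda>r. - p * (1 + k / sqrt (r + m))) has_real_derivative p * k / (2 * sqrt (r + m) ^ 3)) (at r)"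
    using assms sq by (auto intro!: derivative_eq_intros simp: field_simps power3_eq_cube)
  from DERIV_mult[OF this gauss_profile_deriv[OF assms, of k p]]
  show ?thesis
    unfolding gauss_profile'_def[abs_def] gauss_profile''_def
    by (rule DERIV_cong) (simp only: gauss_profile'_def eq)
qed

lemma gauss_profile_second_deriv:
  assumes m: "0 < m" and nn: "\<And>h. 0 \<le> q + b * h + a * h^2"
  shows "has_second_deriv (\<lambda>h. gauss_profile m k p (q + b * h + a * h^2))
    (gauss_profile'' m k p q * b^2 + gauss_profile' m k p q * (2 * a))"
proof (rule has_second_derivI[of _ "\<lambda>h. gauss_profile' m k p (q + b * h + a * h^2) * (b + 2 * a * h)"])
  have in1: "((\<lambda>h. q + b * h + a * h^2) has_real_derivative (b + 2 * a * h)) (at h)" for h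
    by (auto intro!: derivative_eq_intros)
  have pos: "0 < q + b * h + a * h^2 + m" for h using nn[of h] m by simp
  show "((\<lambda>h. gauss_profile m k p (q + b * h + a * h^2)) has_real_derivative
      gauss_profile' m k p (q + b * h + a * h^2) * (b + 2 * a * h)) (at h)" for h
    using DERIV_chain2[OF gauss_profile_deriv[OF pos] in1] .
  have "((\<lambda>h. gauss_profile' m k p (q + b * h + a * h^2)) has_real_derivative
      gauss_profile'' m k p q * b) (at 0)"
    using DERIV_chain2[OF gauss_profile'_deriv[OF pos[of 0], of k p] in1[of 0]] by simp
  moreover have "((\<lambda>h. b + 2 * a * h) has_real_derivative 2 * a) (at 0)"
    by (auto intro!: derivative_eq_intros)
  ultimately show "((\<lambda>h. gauss_profile' m k p (q + b * h + a * h^2) * (b + 2 * a * h)) has_real_derivative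
      gauss_profile'' m k p q * b^2 + gauss_profile' m k p q * (2 * a)) (at 0)"
    by (rule DERIV_cong[OF DERIV_mult]) (simp add: power2_eq_square)
qed

lemma gauss_profile_time_deriv:
  assumes "0 < s + T" "0 < \<theta>"
  shows "((\<lambda>s. gauss_profile m k (1 / (4 * \<theta> * (s + T))) r) has_real_derivative
    (sqrt (r + m) + k)^2 / (4 * \<theta> * (s + T)^2) * gauss_profile m k (1 / (4 * \<theta> * (s + T))) r) (at s)"
proof -
  have "((\<lambda>s. - (1 / (4 * \<theta> * (s + T))) * c) has_real_derivative c / (4 * \<theta> * (s + T)^2)) (at s)" for c
    using assms by (auto intro!: derivative_eq_intros simp: power2_eq_square)
  from DERIV_fun_exp[OF this] show ?thesis
    unfolding gauss_profile_def by (simp only: mult.commute)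
qed

text \<open>The quotient \<open>(w\<^sub>s - \<Delta>w) / w\<close> for the barrier \<open>w\<close>, in linear coordinates of \<open>\<real>\<^sup>n\<close> in which
  \<open>r\<close> is the squared distance to the origin.\<close>

definition barrier_defect :: "real \<Rightarrow> real \<Rightarrow> real \<Rightarrow> real \<Rightarrow> real \<Rightarrow> real \<Rightarrow> real" where
  "barrier_defect n \<theta> m k r s =
     (let p = 1 / (4 * \<theta> * s); \<rho> = sqrt (r + m) in
      (\<rho> + k)^2 / (4 * \<theta> * s^2)
      - 4 * r * (p^2 * (1 + k / \<rho>)^2 + p * k / (2 * \<rho>^3)) + 2 * n * p * (1 + k / \<rho>))"

text \<open>Apart from a term of favourable sign, the defect factors as a positive quantity times
  \<open>2 * n * s - (\<rho> + k) * \<rho> * (r / (\<theta> * \<rho>^2) - 1)\<close>. The value of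
  \<open>m\<close> keeps the last bracket away from 0, and the threshold for \<open>k\<close> then
  beats \<open>2 * n * s\<close>.\<close>

lemma barrier_defect_nonpos:
  assumes th: "0 < \<theta>" "\<theta> < 1" and r: "0 < r0" "r0 \<le> r" and n: "0 \<le> n"
    and m: "m = r0 * (1 - \<theta>) / (2 * \<theta>)"
    and k: "2 * n * T * (1 + \<theta>) / ((1 - \<theta>) * sqrt r0) \<le> k" and s: "0 < s" "s \<le> T"
  shows "barrier_defect n \<theta> m k r s \<le> 0"
proof -
  define \<rho> where "\<rho> = sqrt (r + m)"
  have m0: "m > 0" using th r by (simp add: m)
  have rho2: "\<rho>^2 = r + m" using r m0 by (simp add: \<rho>_def)
  have rho: "sqrt r0 \<le> \<rho>" "0 < sqrt r0" using r m0 by (auto simp: \<rho>_def)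
  then have rho0: "\<rho> > 0" by linarith
  have k0: "0 \<le> k" by (rule order_trans[OF _ k]) (use th n s r in auto)
  \<comment> \<open>Here \<open>m\<close> enters:
    \<open>2 * \<theta> * m = r0 * (1 - \<theta>)\<close>, so replacing \<open>r\<close> by
    \<open>r + m\<close> uses up only part of the surplus allowed by
    \<open>\<theta> < 1\<close>.\<close>
  have "(1 - \<theta>) / (1 + \<theta>) \<le> r / (\<theta> * \<rho>^2) - 1"
  proof -
    have "2 * \<theta> * (r + m) \<le> r * (1 + \<theta>)"
    proof -
      have "2 * \<theta> * m = r0 * (1 - \<theta>)" using th by (simp add: m)
      also have "\<dots> \<le> r * (1 - \<theta>)" using r th by (intro mult_right_mono) auto
      finally show ?thesis by (simp add: algebra_simps)
    qed
    moreover have "0 < r + m" using r m0 by simp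
    ultimately have "2 / (1 + \<theta>) \<le> r / (\<theta> * (r + m))"
      using th by (simp add: divide_simps mult_ac)
    moreover have "(1 - \<theta>) / (1 + \<theta>) = 2 / (1 + \<theta>) - 1" using th by (simp add: field_simps)
    ultimately show ?thesis unfolding rho2 by simp
  qed
  moreover have "2 * n * s * (1 + \<theta>) / (1 - \<theta>) \<le> (\<rho> + k) * \<rho>"
  proof -
    have "2 * n * s * (1 + \<theta>) / (1 - \<theta>) \<le> 2 * n * T * (1 + \<theta>) / (1 - \<theta>)"
      using s n th by (intro divide_right_mono mult_right_mono mult_left_mono) auto
    also have "\<dots> \<le> k * sqrt r0" using k rho th by (simp add: field_simps)
    also have "\<dots> \<le> (\<rho> + k) * \<rho>" using rho rho0 k0 by (intro mult_mono) auto
    finally show ?thesis .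
  qed
  moreover have "0 < (1 - \<theta>) / (1 + \<theta>)" using th by simp
  ultimately have "(2 * n * s * (1 + \<theta>) / (1 - \<theta>)) * ((1 - \<theta>) / (1 + \<theta>)) \<le> (\<rho> + k) * \<rho> * (r / (\<theta> * \<rho>^2) - 1)"
    using rho0 k0 by (intro mult_mono) auto
  also have "(2 * n * s * (1 + \<theta>) / (1 - \<theta>)) * ((1 - \<theta>) / (1 + \<theta>)) = 2 * n * s" using th by simp
  finally have key: "2 * n * s - (\<rho> + k) * \<rho> * (r / (\<theta> * \<rho>^2) - 1) \<le> 0" by simp
  have "(\<rho> + k)^2 / (4 * \<theta> * s^2) - 4 * r * ((1 / (4 * \<theta> * s))^2 * (1 + k / \<rho>)^2) + 2 * n * (1 / (4 * \<theta> * s)) * (1 + k / \<rho>)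
     = (\<rho> + k) / \<rho> / (4 * \<theta> * s^2) * (2 * n * s - (\<rho> + k) * \<rho> * (r / (\<theta> * \<rho>^2) - 1))"
    using rho0 s th by (simp add: field_simps power2_eq_square)
  also have "\<dots> \<le> 0"
    using key rho0 k0 th s by (intro mult_nonneg_nonpos) auto
  finally have "(\<rho> + k)^2 / (4 * \<theta> * s^2) - 4 * r * ((1 / (4 * \<theta> * s))^2 * (1 + k / \<rho>)^2) + 2 * n * (1 / (4 * \<theta> * s)) * (1 + k / \<rho>) \<le> 0" .
  moreover have "0 \<le> 4 * r * ((1 / (4 * \<theta> * s)) * k / (2 * \<rho>^3))"
    using r k0 rho0 th s by (intro mult_nonneg_nonneg divide_nonneg_nonneg) auto
  ultimately show ?thesis
    unfolding barrier_defect_def Let_def \<rho>_def[symmetric] by (simp only: distrib_left)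
qed

text \<open>For small \<open>r\<close> no sign is available. The negative second-order part is
  dropped and the rest, by \<open>s \<le> T\<close>, is at most a constant over \<open>s^2\<close>,
  a growth that the exponential smallness of the barrier outweighs.\<close>

lemma barrier_defect_le:
  assumes th: "0 < \<theta>" "\<theta> < 1" and r: "0 \<le> r" "r \<le> r0" and n: "0 \<le> n"
    and m: "0 < m" and k: "0 \<le> k" and s: "0 < s" "s \<le> T"
  shows "barrier_defect n \<theta> m k r s
    \<le> ((sqrt (r0 + m) + k)^2 + 2 * n * T * (1 + k / sqrt m)) / (4 * \<theta>) / s^2"
proof -
  define \<rho> where "\<rho> = sqrt (r + m)"
  have rho: "sqrt m \<le> \<rho>" "\<rho> \<le> sqrt (r0 + m)" "0 < sqrt m" using r m by (auto simp: \<rho>_def)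
  then have rho0: "\<rho> > 0" by linarith
  have "0 \<le> 4 * r * ((1 / (4 * \<theta> * s))^2 * (1 + k / \<rho>)^2 + (1 / (4 * \<theta> * s)) * k / (2 * \<rho>^3))"
    using r k rho0 th s by (intro mult_nonneg_nonneg add_nonneg_nonneg divide_nonneg_nonneg) auto
  then have "barrier_defect n \<theta> m k r s \<le> (\<rho> + k)^2 / (4 * \<theta> * s^2) + 2 * n * (1 / (4 * \<theta> * s)) * (1 + k / \<rho>)"
    unfolding barrier_defect_def Let_def \<rho>_def[symmetric] by linarith
  also have "\<dots> = ((\<rho> + k)^2 + 2 * n * s * (1 + k / \<rho>)) / (4 * \<theta>) / s^2"
    using s th by (simp add: add_divide_distrib power2_eq_square)
  also have "\<dots> \<le> ((sqrt (r0 + m) + k)^2 + 2 * n * T * (1 + k / sqrt m)) / (4 * \<theta>) / s^2"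
    using rho rho0 k th s n
    by (intro divide_right_mono add_mono power_mono mult_mono divide_left_mono) auto
  finally show ?thesis .
qed

section \<open>Comparison of a supersolution with the barrier\<close>

text \<open>\<open>Q\<close> is the quadratic form dual to the diffusion with coefficients
  \<open>1 / \<mu> j\<close>: the weighted square of its gradient is \<open>4 * Q\<close>, and its
  weighted Laplacian is twice the dimension. Profiles in \<open>Q\<close> therefore behave like
  radial functions under the ordinary heat operator.\<close>

lemma heat_supersolution_lower_bound:
  fixes v g :: "real^'n \<Rightarrow> real \<Rightarrow> real" and e :: "'n \<Rightarrow> real^'n" and \<mu> :: "'n \<Rightarrow> real"
  defines "Q \<equiv> \<lambda>x. \<Sum>j\<in>UNIV. \<mu> j * (x \<bullet> e j)^2"
  assumes on: "\<And>i j. e i \<bullet> e j = (if i = j then 1 else 0)" and mu: "\<And>j. 1 \<le> \<mu> j"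
    and T: "0 < T" and S: "0 < S" and th: "0 < \<theta>" "\<theta> < 1"
    and cont: "continuous_on (UNIV \<times> {-T..0}) (\<lambda>(x, t). v x t)"
    and init: "\<And>x. v x (-T) = 0"
    and decay: "\<And>\<epsilon>. 0 < \<epsilon> \<Longrightarrow> \<forall>\<^sub>F x in at_infinity. \<forall>t\<in>{-T..0}. - \<epsilon> \<le> v x t"
    and super: "\<And>x t. -T < t \<Longrightarrow> t \<le> 0 \<Longrightarrow> \<exists>D d.
        (v x has_real_derivative D) (at t within {..t}) \<and>
        (\<forall>j. has_second_deriv (\<lambda>h. v (x + h *\<^sub>R e j) t) (d j)) \<and>
        (\<Sum>j\<in>UNIV. d j / \<mu> j) + g x t \<le> D"
    and g0: "\<And>x t. -T < t \<Longrightarrow> t \<le> 0 \<Longrightarrow> 0 \<le> g x t"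
    and g: "\<And>x t. norm x < S / 2 \<Longrightarrow> -T < t \<Longrightarrow> t \<le> 0 \<Longrightarrow> (t + T) powr \<alpha> \<le> g x t"
  shows "\<exists>c>0. \<exists>m>0. \<exists>k>0. \<forall>x. \<forall>t\<in>{-T<..0}.
    c * gauss_profile m k (1 / (4 * \<theta> * (t + T))) (Q x) \<le> v x t"
proof -
  let ?n = "real CARD('n)"
  have normQ: "(norm x)^2 \<le> Q x" for x
  proof -
    have "(norm x)^2 = (\<Sum>j\<in>UNIV. 1 * (x \<bullet> e j)^2)"
      using orthonormal_parseval[OF on, of x x] by (simp add: dot_square_norm power2_eq_square)
    also have "\<dots> \<le> Q x" unfolding Q_def by (intro sum_mono mult_right_mono mu) simp
    finally show ?thesis .
  qed
  have Q0: "0 \<le> Q x" for x using normQ[of x] zero_le_power2 order_trans by blast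
  have Qstep: "Q (x + h *\<^sub>R e j) = Q x + (2 * \<mu> j * (x \<bullet> e j)) * h + \<mu> j * h^2" for x h j
  proof -
    have "Q (x + h *\<^sub>R e j) = (\<Sum>i\<in>UNIV. \<mu> i * (x \<bullet> e i)^2
        + (if i = j then (2 * \<mu> j * (x \<bullet> e j)) * h + \<mu> j * h^2 else 0))"
      unfolding Q_def
      by (intro sum.cong) (auto simp: inner_add_left on algebra_simps power2_eq_square)
    also have "\<dots> = Q x + ((2 * \<mu> j * (x \<bullet> e j)) * h + \<mu> j * h^2)"
      unfolding sum.distrib Q_def by simp
    finally show ?thesis by simp
  qed
  \<comment> \<open>Since \<open>Q x\<close> dominates \<open>(norm x)^2\<close>, the region
    \<open>Q x < r0\<close>, where the defect may be positive, lies in the ball where the forcing is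
    bounded below.\<close>
  define r0 where "r0 = (S / 2)^2"
  define m where "m = r0 * (1 - \<theta>) / (2 * \<theta>)"
  define k where "k = max 1 (2 * ?n * T * (1 + \<theta>) / ((1 - \<theta>) * sqrt r0))"
  define a where "a = k^2 / (4 * \<theta>)"
  define K1 where "K1 = ((sqrt (r0 + m) + k)^2 + 2 * ?n * T * (1 + k / sqrt m)) / (4 * \<theta>)"
  have r0: "r0 > 0" using S by (simp add: r0_def)
  have m: "m > 0" using r0 th by (simp add: m_def)
  have k: "k > 0" by (simp add: k_def)
  have a: "a > 0" using k th by (simp add: a_def)
  have K1: "K1 > 0" unfolding K1_def using k m r0 th T
    by (intro divide_pos_pos add_pos_nonneg zero_less_power mult_nonneg_nonneg) (auto intro: add_nonneg_pos)
  obtain K where K: "K > 0" "\<And>s. s \<in> {0<..T} \<Longrightarrow> s powr (- 2 - \<alpha>) * exp (- (a / s)) \<le> K"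
    using powr_mult_exp_inverse_bounded[OF a T, of "- 2 - \<alpha>"] by auto
  \<comment> \<open>In the inner region the defect times the barrier is at most
    \<open>K1 * K * (t + T) powr \<alpha>\<close>, so this \<open>c\<close> makes it no larger than
    the forcing.\<close>
  define c where "c = 1 / (K1 * K)"
  have c: "c > 0" using K1 K by (simp add: c_def)
  define w where "w x t = gauss_profile m k (1 / (4 * \<theta> * (t + T))) (Q x)" for x t
  have w0: "w x t > 0" for x t by (simp add: w_def gauss_profile_def)
  have wle: "w x t \<le> exp (- (a / (t + T)))" if "-T < t" for x t
  proof -
    have "k^2 \<le> (sqrt (Q x + m) + k)^2" using k m Q0[of x] by (intro power_mono) auto
    then have "1 / (4 * \<theta> * (t + T)) * k^2 \<le> 1 / (4 * \<theta> * (t + T)) * (sqrt (Q x + m) + k)^2"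
      using that th by (intro mult_left_mono) auto
    then show ?thesis by (simp add: w_def gauss_profile_def a_def)
  qed
  \<comment> \<open>The preceding bound gives smallness in time; this one gives decay in space,
    uniformly in time, for the condition at infinity.\<close>
  have wle': "w x t \<le> exp (- ((norm x)^2 / (4 * \<theta> * T)))" if "-T < t" "t \<le> 0" for x t
  proof -
    have "(norm x)^2 \<le> (sqrt (Q x + m))^2" using normQ[of x] Q0[of x] m by simp
    also have "\<dots> \<le> (sqrt (Q x + m) + k)^2" using k m Q0[of x] by (intro power_mono) auto
    finally have "(norm x)^2 / (4 * \<theta> * T) \<le> (sqrt (Q x + m) + k)^2 / (4 * \<theta> * (t + T))"
      using that th T by (intro frac_le) auto
    then show ?thesis by (simp add: w_def gauss_profile_def)
  qed
  define dw where "dw x t j = gauss_profile'' m k (1 / (4 * \<theta> * (t + T))) (Q x) * (2 * \<mu> j * (x \<bullet> e j))^2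
      + gauss_profile' m k (1 / (4 * \<theta> * (t + T))) (Q x) * (2 * \<mu> j)" for x t j
  have dw: "has_second_deriv (\<lambda>h. w (x + h *\<^sub>R e j) t) (dw x t j)" for x t j
  proof -
    have nn: "0 \<le> Q x + (2 * \<mu> j * (x \<bullet> e j)) * h + \<mu> j * h^2" for h
      using Q0[of "x + h *\<^sub>R e j"] unfolding Qstep .
    show ?thesis
      unfolding w_def dw_def Qstep by (rule gauss_profile_second_deriv[OF m nn])
  qed
  define wt where "wt x t = (sqrt (Q x + m) + k)^2 / (4 * \<theta> * (t + T)^2) * w x t" for x t
  have wt: "(w x has_real_derivative wt x t) (at t within A)" if "-T < t" for x t A
    unfolding w_def[abs_def] wt_def
    by (rule has_field_derivative_at_within[OF gauss_profile_time_deriv]) (use that th in auto)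
  have defect: "wt x t - (\<Sum>j\<in>UNIV. dw x t j / \<mu> j) = barrier_defect ?n \<theta> m k (Q x) (t + T) * w x t" for x t
  proof -
    let ?p = "1 / (4 * \<theta> * (t + T))"
    have "(\<Sum>j\<in>UNIV. dw x t j / \<mu> j)
        = (\<Sum>j\<in>UNIV. 4 * gauss_profile'' m k ?p (Q x) * (\<mu> j * (x \<bullet> e j)^2) + 2 * gauss_profile' m k ?p (Q x))"
    proof (rule sum.cong[OF refl])
      fix j
      have "\<mu> j \<noteq> 0" using mu[of j] by auto
      then show "dw x t j / \<mu> j = 4 * gauss_profile'' m k ?p (Q x) * (\<mu> j * (x \<bullet> e j)^2) + 2 * gauss_profile' m k ?p (Q x)"
        by (simp add: dw_def add_divide_distrib power2_eq_square)
    qed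
    also have "\<dots> = 4 * gauss_profile'' m k ?p (Q x) * Q x + ?n * (2 * gauss_profile' m k ?p (Q x))"
      by (simp add: sum.distrib Q_def sum_distrib_left)
    finally have sum: "(\<Sum>j\<in>UNIV. dw x t j / \<mu> j)
        = 4 * gauss_profile'' m k ?p (Q x) * Q x + ?n * (2 * gauss_profile' m k ?p (Q x))" .
    have eq: "A * W - (4 * ((B + X) * W) * q + n * (2 * (- p * u * W))) = (A - 4 * q * (B + X) + 2 * n * p * u) * W"
      for A B X W q n p u :: real by (simp add: algebra_simps)
    show ?thesis
      unfolding sum wt_def barrier_defect_def Let_def gauss_profile'_def gauss_profile''_def w_def
      by (rule eq)
  qed
  have sub: "c * (barrier_defect ?n \<theta> m k (Q x) (t + T) * w x t) \<le> g x t" if t: "-T < t" "t \<le> 0" for x t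
  proof (cases "r0 \<le> Q x")
    case True
    have "barrier_defect ?n \<theta> m k (Q x) (t + T) \<le> 0"
      by (rule barrier_defect_nonpos[where T = T]) (use True th r0 t in \<open>auto simp: m_def k_def\<close>)
    then have "c * (barrier_defect ?n \<theta> m k (Q x) (t + T) * w x t) \<le> 0"
      using c w0[of x t] by (intro mult_nonneg_nonpos mult_nonpos_nonneg) auto
    then show ?thesis using g0[OF t, of x] by linarith
  next
    case False
    then have "(norm x)^2 < (S / 2)^2" using normQ[of x] by (simp add: r0_def)
    then have nx: "norm x < S / 2" by (rule power_less_imp_less_base) (use S in simp)
    have s: "0 < t + T" "t + T \<le> T" using t by auto
    have "barrier_defect ?n \<theta> m k (Q x) (t + T) \<le> K1 / (t + T)^2"
      unfolding K1_def by (rule barrier_defect_le) (use False th Q0 m k s in auto)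
    then have "barrier_defect ?n \<theta> m k (Q x) (t + T) * w x t \<le> K1 / (t + T)^2 * exp (- (a / (t + T)))"
      using wle[OF t(1), of x] w0[of x t] K1 by (intro mult_mono) auto
    also have "\<dots> = K1 * (t + T) powr \<alpha> * ((t + T) powr (- 2 - \<alpha>) * exp (- (a / (t + T))))"
    proof -
      have "(t + T) powr \<alpha> * (t + T) powr (- 2 - \<alpha>) = (t + T) powr (- 2)"
        by (simp flip: powr_add)
      also have "\<dots> = 1 / (t + T)^2" using s(1) by (simp add: powr_minus_divide)
      finally have "K1 * ((t + T) powr \<alpha> * (t + T) powr (- 2 - \<alpha>)) * exp (- (a / (t + T)))
          = K1 / (t + T)^2 * exp (- (a / (t + T)))" by simp
      then show ?thesis by (simp only: mult.assoc)
    qed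
    also have "\<dots> \<le> K1 * (t + T) powr \<alpha> * K"
      using K1 s by (intro mult_left_mono K(2)) auto
    finally have "c * (barrier_defect ?n \<theta> m k (Q x) (t + T) * w x t) \<le> c * (K1 * (t + T) powr \<alpha> * K)"
      using c by (intro mult_left_mono) auto
    also have "\<dots> = (t + T) powr \<alpha>" using K1 K by (simp add: c_def)
    also have "\<dots> \<le> g x t" by (rule g[OF nx t])
    finally show ?thesis .
  qed
  have imu: "0 \<le> 1 / \<mu> j" for j using mu[of j] by simp
  \<comment> \<open>A first comparison, with 0. It provides the sign of \<open>v\<close> at the
    later starting time of the second comparison, where the initial value is no longer known to be
    0.\<close>
  have v0: "0 \<le> v x t" if "t \<in> {-T..0}" for x t
  proof (rule parabolic_minimum_principle[where z = v and ?t0.0 = "-T" and ?t1.0 = 0 and I = UNIV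
        and \<kappa> = "\<lambda>j. 1 / \<mu> j" and e = e])
    fix x and t :: real assume t: "-T < t" "t \<le> 0"
    obtain D d where D: "(v x has_real_derivative D) (at t within {..t})"
        "\<forall>j. has_second_deriv (\<lambda>h. v (x + h *\<^sub>R e j) t) (d j)"
        "(\<Sum>j\<in>UNIV. d j / \<mu> j) + g x t \<le> D"
      using super[OF t, of x] by blast
    have "(\<Sum>j\<in>UNIV. 1 / \<mu> j * d j) \<le> D" using D(3) g0[OF t, of x] by simp
    with D(1,2) show "\<exists>D d. (v x has_real_derivative D) (at t within {..t}) \<and>
        (\<forall>j\<in>UNIV. has_second_deriv (\<lambda>h. v (x + h *\<^sub>R e j) t) (d j)) \<and>
        (\<Sum>j\<in>UNIV. 1 / \<mu> j * d j) \<le> D" by blast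
  qed (use cont init decay imu that in auto)
  \<comment> \<open>The formula for \<open>w\<close> has a junk value at \<open>t = -T\<close>, so the comparison starts at
    \<open>-T + \<sigma>\<close> and pays for it with the supremum of \<open>c * w\<close> at that time.\<close>
  have main: "c * w x t - c * exp (- (a / \<sigma>)) \<le> v x t" if \<sigma>: "0 < \<sigma>" "\<sigma> \<le> t + T" "t \<le> 0" for x t \<sigma>
  proof -
    have "0 \<le> v x t - c * w x t + c * exp (- (a / \<sigma>))"
    proof (rule parabolic_minimum_principle[where z = "\<lambda>x t. v x t - c * w x t + c * exp (- (a / \<sigma>))"
          and ?t0.0 = "-T+\<sigma>" and ?t1.0 = 0 and I = UNIV and \<kappa> = "\<lambda>j. 1 / \<mu> j" and e = e])
      have "continuous_on (UNIV \<times> {-T+\<sigma>..0}) (\<lambda>p. w (fst p) (snd p))"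
        unfolding w_def gauss_profile_def Q_def using \<sigma> th
        by (intro continuous_intros) auto
      moreover have "continuous_on (UNIV \<times> {-T+\<sigma>..0}) (\<lambda>p. v (fst p) (snd p))"
        by (rule continuous_on_subset[OF cont[unfolded case_prod_beta]]) (use \<sigma> in auto)
      ultimately show "continuous_on (UNIV \<times> {-T+\<sigma>..0}) (\<lambda>(x, t). v x t - c * w x t + c * exp (- (a / \<sigma>)))"
        unfolding case_prod_beta by (intro continuous_intros)
    next
      fix x
      have "c * w x (-T+\<sigma>) \<le> c * exp (- (a / \<sigma>))"
        using wle[of "-T+\<sigma>" x] \<sigma> c by (intro mult_left_mono) auto
      moreover have "0 \<le> v x (-T+\<sigma>)" using \<sigma> by (intro v0) auto
      ultimately show "0 \<le> v x (-T+\<sigma>) - c * w x (-T+\<sigma>) + c * exp (- (a / \<sigma>))" by linarith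
    next
      fix \<epsilon> :: real assume "0 < \<epsilon>"
      have "\<forall>\<^sub>F x::real^'n in at_infinity. 1 + 4 * \<theta> * T * (a / \<sigma>) \<le> norm x"
        unfolding eventually_at_infinity by blast
      then show "\<forall>\<^sub>F x in at_infinity. \<forall>t\<in>{-T+\<sigma>..0}. - \<epsilon> \<le> v x t - c * w x t + c * exp (- (a / \<sigma>))"
        using decay[OF \<open>0 < \<epsilon>\<close>]
      proof eventually_elim
        case (elim x)
        show ?case
        proof
          fix t assume t: "t \<in> {-T+\<sigma>..0}"
          have "0 \<le> 4 * \<theta> * T * (a / \<sigma>)" using th T a \<sigma> by simp
          then have "1 \<le> norm x" "4 * \<theta> * T * (a / \<sigma>) \<le> norm x" using elim(1) by linarith+
          \<comment> \<open>\<open>norm x\<close> is at most its square, thanks to the summand 1 in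
            the threshold. The barrier then falls below the added constant.\<close>
          then have "4 * \<theta> * T * (a / \<sigma>) \<le> (norm x)^2"
            by (smt (verit) mult_le_cancel_left1 power2_eq_square)
          then have "a / \<sigma> \<le> (norm x)^2 / (4 * \<theta> * T)" using th T by (simp add: field_simps)
          then have "w x t \<le> exp (- (a / \<sigma>))"
            using wle'[of t x] t \<sigma> by (intro order_trans[OF wle'[of t x]]) auto
          then have "c * w x t \<le> c * exp (- (a / \<sigma>))" using c by simp
          moreover have "- \<epsilon> \<le> v x t" using elim(2) t \<sigma> by auto
          ultimately show "- \<epsilon> \<le> v x t - c * w x t + c * exp (- (a / \<sigma>))" by linarith
        qed
      qed
    next
      fix x and t :: real assume "-T+\<sigma> < t" "t \<le> 0"
      then have t: "-T < t" "t \<le> 0" using \<sigma> by auto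
      obtain D d where D: "(v x has_real_derivative D) (at t within {..t})"
        and d: "\<And>j. has_second_deriv (\<lambda>h. v (x + h *\<^sub>R e j) t) (d j)"
        and le: "(\<Sum>j\<in>UNIV. d j / \<mu> j) + g x t \<le> D"
        using super[OF t, of x] by blast
      show "\<exists>D d. ((\<lambda>t. v x t - c * w x t + c * exp (- (a / \<sigma>))) has_real_derivative D) (at t within {..t}) \<and>
        (\<forall>j\<in>UNIV. has_second_deriv (\<lambda>h. v (x + h *\<^sub>R e j) t - c * w (x + h *\<^sub>R e j) t + c * exp (- (a / \<sigma>))) (d j)) \<and>
        (\<Sum>j\<in>UNIV. 1 / \<mu> j * d j) \<le> D"
      proof (intro exI conjI ballI)
        show "((\<lambda>t. v x t - c * w x t + c * exp (- (a / \<sigma>))) has_real_derivative D - c * wt x t + 0) (at t within {..t})"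
          by (intro DERIV_add DERIV_diff DERIV_cmult DERIV_const D wt t)
        fix j
        \<comment> \<open>The constant is written as an affine function of \<open>h\<close>, the
          form covered by the rules for \<open>has_second_deriv\<close>.\<close>
        have "has_second_deriv (\<lambda>h. v (x + h *\<^sub>R e j) t - c * w (x + h *\<^sub>R e j) t + (0 * h + c * exp (- (a / \<sigma>))))
          (d j - c * dw x t j + 0)"
          by (intro has_second_deriv_add has_second_deriv_diff has_second_deriv_cmult has_second_deriv_affine d dw)
        then show "has_second_deriv (\<lambda>h. v (x + h *\<^sub>R e j) t - c * w (x + h *\<^sub>R e j) t + c * exp (- (a / \<sigma>)))
          (d j - c * dw x t j)" by simp
      next
        have "(\<Sum>j\<in>UNIV. 1 / \<mu> j * (d j - c * dw x t j)) = (\<Sum>j\<in>UNIV. d j / \<mu> j) - c * (\<Sum>j\<in>UNIV. dw x t j / \<mu> j)"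
          by (simp add: right_diff_distrib sum_subtractf sum_distrib_left diff_divide_distrib)
        also have "c * (\<Sum>j\<in>UNIV. dw x t j / \<mu> j) = c * wt x t - c * (barrier_defect ?n \<theta> m k (Q x) (t + T) * w x t)"
          using defect[of x t] by (simp flip: right_diff_distrib)
        finally show "(\<Sum>j\<in>UNIV. 1 / \<mu> j * (d j - c * dw x t j)) \<le> D - c * wt x t + 0"
          using le sub[OF t, of x] by linarith
      qed
    qed (use \<sigma> imu in auto)
    then show ?thesis by linarith
  qed
  have "c * w x t \<le> v x t" if t: "t \<in> {-T<..0}" for x t
  proof (rule field_le_epsilon)
    fix \<epsilon> :: real assume "0 < \<epsilon>"
    \<comment> \<open>The error \<open>c * exp (- (a / \<sigma>))\<close> is at most
      \<open>c * \<sigma> / a\<close>, hence at most \<open>\<epsilon>\<close> for this choice; the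
      minimum keeps the starting time no later than \<open>t\<close>.\<close>
    define \<sigma> where "\<sigma> = min (t + T) (a * \<epsilon> / c)"
    have \<sigma>: "0 < \<sigma>" "\<sigma> \<le> t + T" "\<sigma> \<le> a * \<epsilon> / c"
      using t a c \<open>0 < \<epsilon>\<close> by (auto simp: \<sigma>_def)
    have "a / \<sigma> \<le> exp (a / \<sigma>)"
      using exp_ge_add_one_self[of "a / \<sigma>"] by linarith
    then have "exp (- (a / \<sigma>)) \<le> 1 / (a / \<sigma>)"
      unfolding exp_minus inverse_eq_divide using a \<sigma>(1) by (intro frac_le) auto
    then have "c * exp (- (a / \<sigma>)) \<le> c * (\<sigma> / a)"
      using c by (intro mult_left_mono) auto
    also have "\<dots> \<le> \<epsilon>" using \<sigma>(3) c a by (simp add: field_simps)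
    finally show "c * w x t \<le> v x t + \<epsilon>" using main[OF \<sigma>(1,2), of x] t by simp
  qed
  then show ?thesis using c m k unfolding w_def by blast
qed

subsection \<open>Comparison with the quadratic solution\<close>

lemma strictly_convex_imp_convex_on: "strictly_convex v \<Longrightarrow> convex_on UNIV v"
proof (rule convex_onI)
  fix t x y assume v: "strictly_convex v" and t: "(0::real) < t" "t < 1"
  show "v ((1 - t) *\<^sub>R x + t *\<^sub>R y) \<le> (1 - t) * v x + t * v y"
  proof (cases "x = y")
    case True
    then show ?thesis by (simp flip: scaleR_add_left distrib_right)
  next
    case False
    then show ?thesis using v t unfolding strictly_convex_def by (simp add: less_imp_le)
  qed
qed simp

lemma continuous_lower_slice:
  assumes "continuous_lower g" "t \<le> 0"
  shows "continuous_on UNIV (\<lambda>x. g x t)"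
proof -
  have "continuous_on UNIV (\<lambda>x. (x, t))" by (intro continuous_intros)
  from continuous_on_compose2[OF assms(1) this] show ?thesis using assms(2) by auto
qed

lemma C21_slice:
  assumes "C21 u" "t \<le> 0"
  shows "has_partial i (\<lambda>y. u y t) x" "continuous_on UNIV (partial i (\<lambda>y. u y t))"
    "has_partial i (partial j (\<lambda>y. u y t)) x" "continuous_on UNIV (partial i (partial j (\<lambda>y. u y t)))"
proof -
  show "has_partial i (\<lambda>y. u y t) x" "has_partial i (partial j (\<lambda>y. u y t)) x"
    using assms unfolding C21_def by blast+
  have "continuous_lower (\<lambda>x t. partial i (\<lambda>y. u y t) x)"
    using assms(1) unfolding C21_def by blast
  from continuous_lower_slice[OF this assms(2)]
  show "continuous_on UNIV (partial i (\<lambda>y. u y t))" .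
  have "continuous_lower (\<lambda>x t. partial i (partial j (\<lambda>y. u y t)) x)"
    using assms(1) unfolding C21_def by blast
  from continuous_lower_slice[OF this assms(2)]
  show "continuous_on UNIV (partial i (partial j (\<lambda>y. u y t)))" .
qed

lemma quadratic_solution_second_deriv:
  fixes A :: "real^'n^'n"
  shows "has_second_deriv (\<lambda>h. quadratic_solution A b c (x + h *\<^sub>R \<xi>) t) (\<xi> \<bullet> (A *v \<xi>))"
proof -
  have eq: "quadratic_solution A b c (x + h *\<^sub>R \<xi>) t = quadratic_solution A b c x t
      + ((x \<bullet> (A *v \<xi>) + \<xi> \<bullet> (A *v x)) / 2 + b \<bullet> \<xi>) * h + (\<xi> \<bullet> (A *v \<xi>) / 2) * h^2" for h
    by (simp add: quadratic_solution_def matrix_vector_right_distrib matrix_vector_mult_scaleR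
        inner_add_left inner_add_right algebra_simps power2_eq_square add_divide_distrib)
  show ?thesis
    unfolding eq using has_second_deriv_quadratic[where b = "\<xi> \<bullet> (A *v \<xi>) / 2"] by simp
qed

lemma quadratic_solution_convex_imp_nonneg:
  assumes "convex_on UNIV (\<lambda>x. quadratic_solution A b c x t)"
  shows "0 \<le> \<xi> \<bullet> (A *v \<xi>)"
  using second_deriv_nonneg_of_convex[OF quadratic_solution_second_deriv convex_on_line[OF assms]] .

text \<open>In the eigenbasis \<open>M\<close> is diagonal with entries \<open>1 + (l j)^2\<close>,
  all at least 1; every comparison follows termwise.\<close>

lemma quadratic_form_eigenbasis:
  fixes A :: "real^'n^'n" and e :: "'n \<Rightarrow> real^'n"
  assumes on: "\<And>i j. e i \<bullet> e j = (if i = j then 1 else 0)"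
    and sym: "transpose A = A" and ev: "\<And>i. A *v e i = l i *\<^sub>R e i"
    and M: "M = mat 1 + A ** A"
  shows "x \<bullet> (M *v x) = (\<Sum>j\<in>UNIV. (1 + (l j)^2) * (x \<bullet> e j)^2)"
    and "(norm x)^2 \<le> x \<bullet> (M *v x)" and "x \<bullet> (M *v x) \<le> (norm (M *v x))^2"
    and "norm x \<le> norm (M *v x)"
proof -
  have Ae: "(A *v y) \<bullet> e j = l j * (y \<bullet> e j)" for y j
    using inner_symmetric_matrix[OF sym, of y "e j"] ev by simp
  have Mx: "M *v x = x + A *v (A *v x)"
    by (simp add: M matrix_vector_mult_add_rdistrib matrix_vector_mul_assoc)
  have Me: "(M *v x) \<bullet> e j = (1 + (l j)^2) * (x \<bullet> e j)" for j
    by (simp add: Mx inner_add_left Ae algebra_simps power2_eq_square)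
  show eq: "x \<bullet> (M *v x) = (\<Sum>j\<in>UNIV. (1 + (l j)^2) * (x \<bullet> e j)^2)"
    using orthonormal_parseval[OF on, of x "M *v x"] by (simp add: Me power2_eq_square mult_ac)
  have "(norm x)^2 = (\<Sum>j\<in>UNIV. 1 * (x \<bullet> e j)^2)"
    using orthonormal_parseval[OF on, of x x] by (simp add: dot_square_norm power2_eq_square)
  also have "\<dots> \<le> x \<bullet> (M *v x)" unfolding eq by (intro sum_mono mult_right_mono) auto
  finally show 1: "(norm x)^2 \<le> x \<bullet> (M *v x)" .
  have "x \<bullet> (M *v x) \<le> (\<Sum>j\<in>UNIV. (1 + (l j)^2) * ((1 + (l j)^2) * (x \<bullet> e j)^2))"
    unfolding eq
  proof (intro sum_mono mult_left_mono)
    show "(x \<bullet> e j)^2 \<le> (1 + (l j)^2) * (x \<bullet> e j)^2" for j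
      using mult_right_mono[of 1 "1 + (l j)^2" "(x \<bullet> e j)^2"] by simp
  qed simp
  also have "\<dots> = (norm (M *v x))^2"
    using orthonormal_parseval[OF on, of "M *v x" "M *v x"]
    by (simp add: Me dot_square_norm power2_eq_square mult_ac)
  finally show 2: "x \<bullet> (M *v x) \<le> (norm (M *v x))^2" .
  show "norm x \<le> norm (M *v x)" by (rule power2_le_imp_le[OF order_trans[OF 1 2]]) simp
qed

text \<open>This turns the assumed upper bound into decay uniform down to the singular time. For
  large \<open>x\<close> the quadratic form exceeds the linear term by at least 1, so a factor
  \<open>exp (- 1 / (4 * s))\<close> absorbs the power of \<open>s\<close>, and the denominator
  \<open>x \<bullet> (M *v x)\<close> makes the remainder small.\<close>

lemma gaussian_majorant_vanishes:
  fixes M :: "real^'n^'n"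
  assumes M: "\<And>x. (norm x)^2 \<le> x \<bullet> (M *v x)"
    and C: "0 < C" and S: "0 \<le> S" and T: "0 < T" and \<epsilon>: "0 < \<epsilon>"
  shows "\<forall>\<^sub>F x in at_infinity. \<forall>s\<in>{0<..T}.
    C / (s powr p * (x \<bullet> (M *v x))) * exp (- ((x \<bullet> (M *v x) - S * norm (M *v x)) / (4 * s))) \<le> \<epsilon>"
proof -
  obtain K where K: "K > 0" "\<And>s. s \<in> {0<..T} \<Longrightarrow> s powr (- p) * exp (- ((1 / 4) / s)) \<le> K"
    using powr_mult_exp_inverse_bounded[of "1 / 4" T "- p"] T by auto
  define B where "B = onorm ((*v) M)"
  have B: "norm (M *v x) \<le> B * norm x" "0 \<le> B" for x
    unfolding B_def by (auto intro: onorm onorm_pos_le matrix_vector_mul_bounded_linear)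
  have "C / (s powr p * (x \<bullet> (M *v x))) * exp (- ((x \<bullet> (M *v x) - S * norm (M *v x)) / (4 * s))) \<le> \<epsilon>"
    if x: "1 + S * B + C * K / \<epsilon> \<le> norm x" and s: "s \<in> {0<..T}" for x s
  proof -
    have "0 \<le> S * B" "0 \<le> C * K / \<epsilon>" using S B C K \<epsilon> by auto
    then have nx: "1 \<le> norm x" "S * B + 1 \<le> norm x" "C * K / \<epsilon> \<le> norm x" using x by linarith+
    define q where "q = x \<bullet> (M *v x)"
    have "norm x * 1 \<le> norm x * norm x" using nx by (intro mult_left_mono) auto
    then have qx: "norm x \<le> q" using M[of x] by (simp add: q_def power2_eq_square)
    have "S * norm (M *v x) \<le> S * (B * norm x)" using B S by (intro mult_left_mono)
    moreover have "1 * 1 \<le> norm x * (norm x - S * B)" using nx by (intro mult_mono) auto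
    ultimately have "1 \<le> q - S * norm (M *v x)"
      using M[of x] by (simp add: q_def power2_eq_square algebra_simps)
    then have "1 / (4 * s) \<le> (q - S * norm (M *v x)) / (4 * s)"
      using s by (intro divide_right_mono) auto
    then have "C / (s powr p * q) * exp (- ((q - S * norm (M *v x)) / (4 * s)))
        \<le> C / (s powr p * q) * exp (- ((1 / 4) / s))"
      using C qx nx by (intro mult_left_mono divide_nonneg_nonneg mult_nonneg_nonneg) auto
    also have "\<dots> = C / q * (s powr (- p) * exp (- ((1 / 4) / s)))"
      by (simp add: powr_minus divide_simps)
    also have "\<dots> \<le> C / q * K" using C qx nx by (intro mult_left_mono K(2) s) auto
    also have "\<dots> \<le> \<epsilon>"
    proof -
      have "C * K \<le> \<epsilon> * q" using nx(3) qx \<epsilon> by (simp add: field_simps order_trans[of _ "\<epsilon> * norm x"])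
      then show ?thesis using qx nx by (simp add: field_simps)
    qed
    finally show ?thesis by (simp add: q_def)
  qed
  then show ?thesis unfolding eventually_at_infinity by blast
qed

text \<open>To be applied with \<open>q = x \<bullet> (M *v x)\<close> and
  \<open>r = norm (M *v x)\<close>. Expanding the square costs at most \<open>(S - 1) * r\<close>
  beyond \<open>q\<close>. The spare \<open>r\<close> yields a factor
  \<open>exp (- 1 / (4 * s))\<close>, as \<open>\<theta> \<le> r\<close>, and this factor absorbs
  the power of \<open>s\<close>; \<open>1 / q\<close> is bounded by 1.\<close>

lemma gauss_profile_absorbs_powers:
  fixes q r s :: real
  assumes th: "0 < \<theta>" "\<theta> < 1" and k: "0 < k" and m: "0 < m"
    and r: "1 \<le> r" and q: "1 \<le> q" "q \<le> r^2" and s: "0 < s"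
    and K: "0 < K" "s powr (- p) * exp (- ((1 / 4) / s)) \<le> K" and c: "0 < c"
    and S: "2 * k + (sqrt m + k)^2 + 1 \<le> S"
  shows "c / K / (s powr p * q) * exp (- ((q + S * r) / (4 * \<theta> * s)))
    \<le> c * gauss_profile m k (1 / (4 * \<theta> * s)) q"
proof -
  have "sqrt q \<le> r" using q r by (intro real_le_lsqrt) auto
  then have rho: "sqrt (q + m) \<le> r + sqrt m"
    using sqrt_add_le_add_sqrt[of q m] q m by simp
  have "(sqrt (q + m) + k)^2 = q + m + 2 * k * sqrt (q + m) + k^2"
    using q m by (simp add: power2_sum)
  also have "\<dots> \<le> q + m + 2 * k * (r + sqrt m) + k^2"
    using rho k by simp
  also have "\<dots> = q + 2 * k * r + (sqrt m + k)^2 * 1"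
    using m by (simp add: power2_sum algebra_simps)
  also have "\<dots> \<le> q + 2 * k * r + (sqrt m + k)^2 * r"
    using r by (intro add_left_mono mult_left_mono) auto
  also have "\<dots> \<le> q + (S - 1) * r"
  proof -
    have "(2 * k + (sqrt m + k)^2) * r \<le> (S - 1) * r" using S r by (intro mult_right_mono) auto
    then show ?thesis by (simp add: algebra_simps)
  qed
  finally have "(sqrt (q + m) + k)^2 + r \<le> q + S * r" by (simp add: algebra_simps)
  then have "((sqrt (q + m) + k)^2 + r) / (4 * \<theta> * s) \<le> (q + S * r) / (4 * \<theta> * s)"
    using th s by (intro divide_right_mono) auto
  moreover have "(1 / 4) / s \<le> r / (4 * \<theta> * s)"
  proof -
    have "\<theta> \<le> r" using th r by simp
    then show ?thesis using th s by (simp add: field_simps)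
  qed
  ultimately have "1 / (4 * \<theta> * s) * (sqrt (q + m) + k)^2 + (1 / 4) / s \<le> (q + S * r) / (4 * \<theta> * s)"
    by (simp add: add_divide_distrib)
  then have "exp (- ((q + S * r) / (4 * \<theta> * s)))
      \<le> exp (- (1 / (4 * \<theta> * s)) * (sqrt (q + m) + k)^2 + - ((1 / 4) / s))"
    by simp
  also have "\<dots> = gauss_profile m k (1 / (4 * \<theta> * s)) q * exp (- ((1 / 4) / s))"
    unfolding gauss_profile_def by (rule exp_add)
  finally have le: "exp (- ((q + S * r) / (4 * \<theta> * s))) \<le> gauss_profile m k (1 / (4 * \<theta> * s)) q * exp (- ((1 / 4) / s))" .
  have g: "0 < gauss_profile m k (1 / (4 * \<theta> * s)) q" by (simp add: gauss_profile_def)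
  have "c / K / (s powr p * q) * exp (- ((q + S * r) / (4 * \<theta> * s)))
      \<le> c / K / (s powr p * 1) * (gauss_profile m k (1 / (4 * \<theta> * s)) q * exp (- ((1 / 4) / s)))"
    using le c K(1) q s by (intro mult_mono divide_left_mono mult_left_mono) auto
  also have "\<dots> = c / K * gauss_profile m k (1 / (4 * \<theta> * s)) q * (s powr (- p) * exp (- ((1 / 4) / s)))"
    by (simp add: powr_minus divide_simps)
  also have "\<dots> \<le> c / K * gauss_profile m k (1 / (4 * \<theta> * s)) q * K"
    using c K g by (intro mult_left_mono) auto
  finally show ?thesis using K(1) by simp
qed

text \<open>Concavity of \<open>sum_arctan\<close> on nonnegative matrices makes \<open>quadratic_solution - u\<close> a
  supersolution of an equation with constant coefficients.\<close>

lemma difference_supersolution: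
  fixes u :: "real^'n \<Rightarrow> real \<Rightarrow> real" and e :: "'n \<Rightarrow> real^'n"
  assumes sol: "classical_solution f u" and conv: "convex_on UNIV (\<lambda>x. u x t)" and t: "t \<le> 0"
    and on: "\<And>i j. e i \<bullet> e j = (if i = j then 1 else 0)"
    and ev: "\<And>i. A *v e i = l i *\<^sub>R e i" and l: "\<And>i. 0 \<le> l i"
  shows "\<exists>D d. ((\<lambda>t. quadratic_solution A b c x t - u x t) has_real_derivative D) (at t within {..t}) \<and>
    (\<forall>j. has_second_deriv (\<lambda>h. quadratic_solution A b c (x + h *\<^sub>R e j) t - u (x + h *\<^sub>R e j) t) (d j)) \<and>
    (\<Sum>j\<in>UNIV. d j / (1 + (l j)^2)) + - f x t \<le> D"
proof (intro exI conjI allI)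
  have C: "C21 u" using sol by (simp add: classical_solution_def)
  note slice = C21_slice[OF C t]
  have "(u x has_vector_derivative Dt u x t) (at t within {..0})"
    using C t unfolding C21_def Dt_def by (simp add: vector_derivative_works)
  then have "(u x has_real_derivative Dt u x t) (at t within {..0})"
    by (simp add: has_real_derivative_iff_has_vector_derivative)
  \<comment> \<open>Left derivatives treat \<open>t = 0\<close>, where nothing else is available,
    like every other time.\<close>
  then have ut: "(u x has_real_derivative Dt u x t) (at t within {..t})"
    by (rule DERIV_subset) (use t in auto)
  have "((\<lambda>t. quadratic_solution A b c x t) has_real_derivative sum_arctan A) (at t within {..t})"
    unfolding quadratic_solution_def by (auto intro!: derivative_eq_intros)
  from DERIV_diff[OF this ut]
  show "((\<lambda>t. quadratic_solution A b c x t - u x t) has_real_derivative sum_arctan A - Dt u x t) (at t within {..t})" .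
  have "e j \<bullet> (A *v e j) = l j" for j using ev on by simp
  then show "has_second_deriv (\<lambda>h. quadratic_solution A b c (x + h *\<^sub>R e j) t - u (x + h *\<^sub>R e j) t)
      (l j - e j \<bullet> (D2 u x t *v e j))" for j
    using has_second_deriv_diff[OF quadratic_solution_second_deriv[of A b c x "e j" t]
        hessian_has_second_deriv[OF slice, of x "e j"]] by (simp add: D2_def)
  have "sum_arctan (D2 u x t)
      \<le> sum_arctan A + (\<Sum>j\<in>UNIV. (e j \<bullet> (D2 u x t *v e j) - l j) / (1 + (l j)^2))"
    unfolding D2_def
    by (intro sum_arctan_le_linearization on ev l hessian_symmetric hessian_nonneg_of_convex slice conv)
  moreover have "(\<Sum>j\<in>UNIV. (e j \<bullet> (D2 u x t *v e j) - l j) / (1 + (l j)^2))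
      = - (\<Sum>j\<in>UNIV. (l j - e j \<bullet> (D2 u x t *v e j)) / (1 + (l j)^2))"
    unfolding sum_negf[symmetric] by (intro sum.cong refl) (simp only: minus_divide_left minus_diff_eq)
  moreover have "Dt u x t = sum_arctan (D2 u x t) + f x t"
    using sol t by (simp add: classical_solution_def)
  ultimately show "(\<Sum>j\<in>UNIV. (l j - e j \<bullet> (D2 u x t *v e j)) / (1 + (l j)^2)) + - f x t
      \<le> sum_arctan A - Dt u x t" by linarith
qed

section \<open>The lower bound for the error\<close>

theorem mainTheorem2:
  fixes u f E :: "real^'n \<Rightarrow> real \<Rightarrow> real"
    and A M :: "real^'n^'n" and b :: "real^'n"
    and \<epsilon> \<alpha> S T c C\<^sub>0 S' :: real
  assumes "2 \<le> CARD('n)"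
    and "0 < \<alpha>" "\<alpha> < 1/2"
    and "liouville_constant TYPE('n) \<epsilon>"
    and "0 < S" "condition_F f S T"
    and "\<forall>x. \<forall>t\<le>0. f x t \<le> 0"
    and "\<forall>x\<in>ball 0 (S/2). \<forall>t\<in>{-T..0}. f x t \<le> - ((t + T) powr \<alpha>)"
    and "classical_solution f u"
    and "\<forall>t\<le>0. strictly_convex (\<lambda>x. u x t)"
    and "hypothesis_a \<epsilon> u \<or> hypothesis_b u"
    and "transpose A = A"
    and M: "M = mat 1 + A ** A"
    and E: "E = (\<lambda>x t. u x t - quadratic_solution A b c x t)"
    and "\<forall>x. \<forall>t\<le>-T. E x t = 0"
    and "0 < C\<^sub>0" "S < S'"
    and "\<forall>\<^sub>F x in at_infinity. \<forall>t\<in>{-T<..0}.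
           \<bar>E x t\<bar> \<le> C\<^sub>0 / ((t + T) powr (real CARD('n) / 2 - 2) * (x \<bullet> (M *v x)))
                     * exp (- ((x \<bullet> (M *v x) - S' * norm (M *v x)) / (4 * (t + T))))"
  shows "\<forall>\<beta>. 0 < \<beta> \<and> \<beta> < 1 \<longrightarrow>
           (\<exists>C>0. \<exists>S''>S. \<forall>\<^sub>F x in at_infinity. \<forall>t\<in>{-T<..0}.
              \<bar>E x t\<bar> \<ge> C / ((t + T) powr (real CARD('n) / 2 - \<alpha> - 2) * (x \<bullet> (M *v x)))
                        * exp (- ((x \<bullet> (M *v x) + S'' * norm (M *v x)) / (4 * (1 - \<beta>) * (t + T)))))"
proof (intro allI impI)
  fix \<beta> :: real assume \<beta>: "0 < \<beta> \<and> \<beta> < 1"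
  let ?n = "real CARD('n)"
  let ?rhs = "\<lambda>C S'' x t. C / ((t + T) powr (?n / 2 - \<alpha> - 2) * (x \<bullet> (M *v x)))
                        * exp (- ((x \<bullet> (M *v x) + S'' * norm (M *v x)) / (4 * (1 - \<beta>) * (t + T))))"
  show "\<exists>C>0. \<exists>S''>S. \<forall>\<^sub>F x in at_infinity. \<forall>t\<in>{-T<..0}. \<bar>E x t\<bar> \<ge> ?rhs C S'' x t"
  proof (cases "0 < T")
    case False
    then have "{-T<..0} = {}" by auto
    then show ?thesis by (intro exI[of _ 1] conjI exI[of _ "S + 1"]) auto
  next
    case T: True
    obtain e :: "'n \<Rightarrow> real^'n" and l :: "'n \<Rightarrow> real"
      where on: "\<And>i j. e i \<bullet> e j = (if i = j then 1 else 0)" and ev: "\<And>i. A *v e i = l i *\<^sub>R e i"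
      using symmetric_orthonormal_eigenbasis[OF assms(12)] by metis
    have conv: "convex_on UNIV (\<lambda>x. u x t)" if "t \<le> 0" for t
      using assms(10) that strictly_convex_imp_convex_on by blast
    \<comment> \<open>At \<open>t = -T\<close> the solution coincides with the quadratic one, which
      therefore inherits convexity; evaluating its second derivative along \<open>e i\<close> gives
      the sign.\<close>
    have l: "0 \<le> l i" for i
    proof -
      have "(\<lambda>x. quadratic_solution A b c x (-T)) = (\<lambda>x. u x (-T))"
        using assms(15) by (simp add: E)
      then have "convex_on UNIV (\<lambda>x. quadratic_solution A b c x (-T))"
        using conv[of "-T"] T by simp
      then show ?thesis
        using quadratic_solution_convex_imp_nonneg[of A b c "-T" "e i"] ev[of i] on[of i i] by simp
    qed
    note q = quadratic_form_eigenbasis[OF on assms(12) ev M]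
    define v where "v x t = quadratic_solution A b c x t - u x t" for x t
    have vE: "v x t = - E x t" for x t by (simp add: v_def E)
    have "\<exists>c>0. \<exists>m>0. \<exists>k>0. \<forall>x. \<forall>t\<in>{-T<..0}.
      c * gauss_profile m k (1 / (4 * (1 - \<beta>) * (t + T))) (\<Sum>j\<in>UNIV. (1 + (l j)^2) * (x \<bullet> e j)^2) \<le> v x t"
    proof (rule heat_supersolution_lower_bound[OF on, where S = S and \<alpha> = \<alpha> and g = "\<lambda>x t. - f x t"])
      have "continuous_lower u" using assms(9) by (simp add: classical_solution_def C21_def)
      then have "continuous_on (UNIV \<times> {-T..0}) (\<lambda>p. u (fst p) (snd p))"
        unfolding case_prod_beta by (rule continuous_on_subset) auto
      moreover have "continuous_on (UNIV \<times> {-T..0}) (\<lambda>p. quadratic_solution A b c (fst p) (snd p))"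
        unfolding quadratic_solution_def
        by (intro continuous_intros linear_continuous_on_compose[OF _ matrix_vector_mul_linear])
      ultimately show "continuous_on (UNIV \<times> {-T..0}) (\<lambda>(x, t). v x t)"
        unfolding v_def case_prod_beta by (intro continuous_intros)
      show "v x (-T) = 0" for x using assms(15) by (simp add: vE)
      show "\<forall>\<^sub>F x in at_infinity. \<forall>t\<in>{-T..0}. - \<epsilon> \<le> v x t" if "0 < \<epsilon>" for \<epsilon>
      proof -
        have "0 \<le> S'" using assms(5,17) by simp
        from assms(18) gaussian_majorant_vanishes[OF q(2) assms(16) this T that, of "?n / 2 - 2"]
        show ?thesis
        proof eventually_elim
          case (elim x)
          show ?case
          proof
            fix t assume t: "t \<in> {-T..0}"
            \<comment> \<open>The majorant is assumed for \<open>t > -T\<close> only; at the initial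
              time \<open>E\<close> vanishes.\<close>
            show "- \<epsilon> \<le> v x t"
            proof (cases "t = -T")
              case True
              then show ?thesis using assms(15) that by (simp add: vE)
            next
              case False
              then have "t \<in> {-T<..0}" "t + T \<in> {0<..T}" using t by auto
              with elim have "\<bar>E x t\<bar> \<le> \<epsilon>" by (meson order_trans)
              then show ?thesis by (simp add: vE)
            qed
          qed
        qed
      qed
      fix x t assume t: "-T < t" "t \<le> (0::real)"
      show "\<exists>D d. (v x has_real_derivative D) (at t within {..t}) \<and>
          (\<forall>j. has_second_deriv (\<lambda>h. v (x + h *\<^sub>R e j) t) (d j)) \<and>
          (\<Sum>j\<in>UNIV. d j / (1 + (l j)^2)) + - f x t \<le> D"
        unfolding v_def by (rule difference_supersolution[OF assms(9) conv[OF t(2)] t(2) on ev l])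
      show "0 \<le> - f x t" using assms(7) t by simp
      show "(t + T) powr \<alpha> \<le> - f x t" if "norm x < S / 2"
      proof -
        have "x \<in> ball 0 (S / 2)" "t \<in> {-T..0}" using that t by auto
        then have "f x t \<le> - ((t + T) powr \<alpha>)" using assms(8) by blast
        then show ?thesis by linarith
      qed
    qed (use T assms(5) \<beta> in auto)
    then obtain c0 m k where c0: "c0 > 0" and m: "m > 0" and k: "k > 0" and
      low: "\<And>x t. t \<in> {-T<..0} \<Longrightarrow> c0 * gauss_profile m k (1 / (4 * (1 - \<beta>) * (t + T))) (x \<bullet> (M *v x)) \<le> v x t"
      unfolding q(1)[symmetric] by blast
    obtain K where K: "K > 0"
      "\<And>s. s \<in> {0<..T} \<Longrightarrow> s powr (- (?n / 2 - \<alpha> - 2)) * exp (- ((1 / 4) / s)) \<le> K"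
      using powr_mult_exp_inverse_bounded[of "1 / 4" T "- (?n / 2 - \<alpha> - 2)"] T by auto
    \<comment> \<open>All but the last summand is what absorbing the powers requires; adding
      \<open>S\<close> ensures \<open>S < S''\<close>.\<close>
    define S'' where "S'' = 2 * k + (sqrt m + k)^2 + 1 + S"
    have "\<bar>E x t\<bar> \<ge> ?rhs (c0 / K) S'' x t" if x: "1 \<le> norm x" and t: "t \<in> {-T<..0}" for x t
    proof -
      have "1 \<le> (norm x)^2" using x by simp
      then have "1 \<le> x \<bullet> (M *v x)" using q(2)[of x] by linarith
      moreover have "1 \<le> norm (M *v x)" using x q(4)[of x] by linarith
      moreover have s: "t + T \<in> {0<..T}" using t by auto
      ultimately have "?rhs (c0 / K) S'' x t \<le> c0 * gauss_profile m k (1 / (4 * (1 - \<beta>) * (t + T))) (x \<bullet> (M *v x))"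
        using \<beta> assms(5)
        by (intro gauss_profile_absorbs_powers k m q(3) K c0) (auto simp: S''_def)
      also have "\<dots> \<le> v x t" by (rule low[OF t])
      also have "\<dots> \<le> \<bar>E x t\<bar>" by (simp add: vE)
      finally show ?thesis .
    qed
    then have "\<forall>\<^sub>F x in at_infinity. \<forall>t\<in>{-T<..0}. \<bar>E x t\<bar> \<ge> ?rhs (c0 / K) S'' x t"
      unfolding eventually_at_infinity by blast
    moreover have "S < S''" using k by (simp add: S''_def add_pos_nonneg)
    moreover have "0 < c0 / K" using c0 K by simp
    ultimately show ?thesis by blast
  qed
qed

end
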